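(* The category $\mathbf{ACC}$ of attribute continuous formal contexts with $\mathcal{F}$-morphisms is equivalent to the category $\mathbf{CD}$ of continuous domains with Scott-continuous functions.
   Context: Domain theory. A dcpo is a poset in which every directed (nonempty, upward directed) subset has a least upper bound. In a dcpo $P$, $x\ll y$ means: for every directed $D\subseteq P$ with $y\leq\bigvee D$ there is $d\in D$ with $x\leq d$. A basis of $P$ is a subset $B\subseteq P$ such that for every $x\in P$ the set $\{b\in B: b\ll x\}$ is directed with least upper bound $x$. A continuous domain is a dcpo that has a basis. A function $f$ between continuous domains is Scott-continuous if $f(\bigvee D)=\bigvee_{x\in D}f(x)$ for all directed $D$. $\mathbf{CD}$ is the category of continuous domains and Scott-continuous functions. Notation: $M\sqsubseteq X$ means that $M$ is a finite subset of $X$ (possibly empty). A formal context is a triple $(P_o,P_a,\vDash)$ with sets $P_o$ (objects), $P_a$ (attributes) and a relation $\vDash\subseteq P_o\times P_a$. Define $\alpha(A)=\{n\in P_a:\forall m\in A,\ m\vDash n\}$ for $A\subseteq P_o$ and $\omega(B)=\{m\in P_o:\forall n\in B,\ m\vDash n\}$ for $B\subseteq P_a$. A kernel attribute operator on $(P_o,P_a,\vDash)$ is a map $\tau:\mathcal{P}(P_a)\to\mathcal{P}(P_a)$ such that for all $B,B_1\subseteq P_a$: $\tau(\alpha(\omega(B)))\subseteq\alpha(\omega(B))$; $\tau(\tau(\alpha(\omega(B))))=\tau(\alpha(\omega(B)))$; and $\tau(\alpha(\omega(B)))\subseteq\tau(\alpha(\omega(B_1)))$ whenever $B\subseteq B_1$.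 Write $\lceil B\rceil=\tau(\alpha(\omega(B)))$ (in a second context, the brackets are formed with its own operator). A $\tau$-consistent selection is a nonempty family $\mathcal{F}_\tau$ of nonempty finite subsets of $P_a$ such that for every $F\in\mathcal{F}_\tau$ and every $M\sqsubseteq\lceil F\rceil$ there is $G\in\mathcal{F}_\tau$ with $M\subseteq\lceil G\rceil$ and $G\subseteq\lceil F\rceil$. An attribute continuous formal context is a structure $\mathbb{P}_\tau=(P_o,P_a,\vDash,\mathcal{F}_\tau)$ where $(P_o,P_a,\vDash)$ is a formal context, $\tau$ is a kernel attribute operator on it and $\mathcal{F}_\tau$ is a $\tau$-consistent selection. An $\mathcal{F}$-morphism $\mathbb{H}:\mathbb{P}_\tau\to\mathbb{P}'_{\tau'}$, where $\mathbb{P}'_{\tau'}=(P'_o,P'_a,\vDash',\mathcal{F}'_{\tau'})$, is a relation $\mathbb{H}\subseteq\mathcal{F}_\tau\times P'_a$ such that, writing $F\mathbb{H}X'$ for "$(F,x')\in\mathbb{H}$ for all $x'\in X'$", for all $F,G\in\mathcal{F}_\tau$, $F'\in\mathcal{F}'_{\tau'}$, $x'\in P'_a$, $M'\sqsubseteq P'_a$: (AR1) if $F\mathbb{H}F'$ and $x'\in\lceil F'\rceil$ then $(F,x')\in\mathbb{H}$; (AR2) if $G\subseteq\lceil F\rceil$ and $(G,x')\in\mathbb{H}$ then $(F,x')\in\mathbb{H}$; (AR3) if $F\mathbb{H}M'$ then there is $K'\in\mathcal{F}'_{\tau'}$ with $M'\subseteq K'$ and $F\mathbb{H}K'$; (AR4)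 if $(F,x')\in\mathbb{H}$ then there are $K\in\mathcal{F}_\tau$, $K'\in\mathcal{F}'_{\tau'}$ with $K\subseteq\lceil F\rceil$, $x'\in\lceil K'\rceil$ and $K\mathbb{H}K'$. $\mathbf{ACC}$ has attribute continuous formal contexts as objects and $\mathcal{F}$-morphisms as morphisms. The composite of $\mathbb{H}:\mathbb{P}_\tau\to\mathbb{P}'_{\tau'}$ followed by $\mathbb{H}':\mathbb{P}'_{\tau'}\to\mathbb{P}''_{\tau''}$ is the relation consisting of those $(F,x'')\in\mathcal{F}_\tau\times P''_a$ for which there is $G\in\mathcal{F}'_{\tau'}$ with $F\mathbb{H}G$ and $(G,x'')\in\mathbb{H}'$. The identity on $\mathbb{P}_\tau$ is $\{(F,x)\in\mathcal{F}_\tau\times P_a: x\in\lceil F\rceil\}$.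
   Formalization: With (AR3) as written identities can fail; proved with M'⊆⌈K'⌉ for all contexts, and with literal (AR3) for contexts whose identity is an F-morphism. The empty domain, which has no matching context, is excluded; objects are taken below an arbitrary size bound. *)

theory Defs
  imports "HOL-Library.FuncSet"
begin

unbundle cardinal_syntax

section \<open>Categories and equivalence of categories\<close>

text \<open>Hom-sets of distinct pairs of objects may overlap, so the morphism part of a functor takes
  source and target as arguments.  Composition is written in diagrammatic order:
  \<open>Comp C X Y Z f g\<close> is \<open>f : X \<rightarrow> Y\<close> followed by \<open>g : Y \<rightarrow> Z\<close>.\<close>

record ('o, 'm) category =
  Ob :: "'o set"
  Hom :: "'o \<Rightarrow> 'o \<Rightarrow> 'm set"
  Ident :: "'o \<Rightarrow> 'm"
  Comp :: "'o \<Rightarrow> 'o \<Rightarrow> 'o \<Rightarrow> 'm \<Rightarrow> 'm \<Rightarrow> 'm"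

definition is_category :: "('o, 'm) category \<Rightarrow> bool" where
  "is_category C \<longleftrightarrow>
    (\<forall>X\<in>Ob C. Ident C X \<in> Hom C X X) \<and>
    (\<forall>X\<in>Ob C. \<forall>Y\<in>Ob C. \<forall>Z\<in>Ob C. \<forall>f\<in>Hom C X Y. \<forall>g\<in>Hom C Y Z.
        Comp C X Y Z f g \<in> Hom C X Z) \<and>
    (\<forall>X\<in>Ob C. \<forall>Y\<in>Ob C. \<forall>f\<in>Hom C X Y.
        Comp C X X Y (Ident C X) f = f \<and> Comp C X Y Y f (Ident C Y) = f) \<and>
    (\<forall>W\<in>Ob C. \<forall>X\<in>Ob C. \<forall>Y\<in>Ob C. \<forall>Z\<in>Ob C.
      \<forall>f\<in>Hom C W X. \<forall>g\<in>Hom C X Y. \<forall>h\<in>Hom C Y Z.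
        Comp C W Y Z (Comp C W X Y f g) h = Comp C W X Z f (Comp C X Y Z g h))"

definition isomorphism :: "('o, 'm) category \<Rightarrow> 'o \<Rightarrow> 'o \<Rightarrow> 'm \<Rightarrow> bool" where
  "isomorphism C X Y f \<longleftrightarrow> f \<in> Hom C X Y \<and>
    (\<exists>g\<in>Hom C Y X. Comp C X Y X f g = Ident C X \<and> Comp C Y X Y g f = Ident C Y)"

record ('o1, 'm1, 'o2, 'm2) functor_data =
  on_ob :: "'o1 \<Rightarrow> 'o2"
  on_hom :: "'o1 \<Rightarrow> 'o1 \<Rightarrow> 'm1 \<Rightarrow> 'm2"

definition is_functor ::
  "('o1, 'm1) category \<Rightarrow> ('o2, 'm2) category \<Rightarrow> ('o1, 'm1, 'o2, 'm2) functor_data \<Rightarrow> bool" where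
  "is_functor C D F \<longleftrightarrow>
    (\<forall>X\<in>Ob C. on_ob F X \<in> Ob D) \<and>
    (\<forall>X\<in>Ob C. \<forall>Y\<in>Ob C. \<forall>f\<in>Hom C X Y.
        on_hom F X Y f \<in> Hom D (on_ob F X) (on_ob F Y)) \<and>
    (\<forall>X\<in>Ob C. on_hom F X X (Ident C X) = Ident D (on_ob F X)) \<and>
    (\<forall>X\<in>Ob C. \<forall>Y\<in>Ob C. \<forall>Z\<in>Ob C. \<forall>f\<in>Hom C X Y. \<forall>g\<in>Hom C Y Z.
        on_hom F X Z (Comp C X Y Z f g) =
        Comp D (on_ob F X) (on_ob F Y) (on_ob F Z) (on_hom F X Y f) (on_hom F Y Z g))"

definition id_functor :: "('o, 'm, 'o, 'm) functor_data" where
  "id_functor = \<lparr>on_ob = (\<lambda>X. X), on_hom = (\<lambda>X Y f. f)\<rparr>"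

definition functor_comp ::
  "('o1, 'm1, 'o2, 'm2) functor_data \<Rightarrow> ('o2, 'm2, 'o3, 'm3) functor_data \<Rightarrow>
    ('o1, 'm1, 'o3, 'm3) functor_data" where
  "functor_comp F G =
    \<lparr>on_ob = (\<lambda>X. on_ob G (on_ob F X)),
     on_hom = (\<lambda>X Y f. on_hom G (on_ob F X) (on_ob F Y) (on_hom F X Y f))\<rparr>"

definition naturally_isomorphic ::
  "('o1, 'm1) category \<Rightarrow> ('o2, 'm2) category \<Rightarrow>
    ('o1, 'm1, 'o2, 'm2) functor_data \<Rightarrow> ('o1, 'm1, 'o2, 'm2) functor_data \<Rightarrow> bool" where
  "naturally_isomorphic C D F G \<longleftrightarrow>
    (\<exists>\<eta>. (\<forall>X\<in>Ob C. isomorphism D (on_ob F X) (on_ob G X) (\<eta> X)) \<and>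
      (\<forall>X\<in>Ob C. \<forall>Y\<in>Ob C. \<forall>f\<in>Hom C X Y.
        Comp D (on_ob F X) (on_ob F Y) (on_ob G Y) (on_hom F X Y f) (\<eta> Y) =
        Comp D (on_ob F X) (on_ob G X) (on_ob G Y) (\<eta> X) (on_hom G X Y f)))"

definition equivalent_categories :: "('o1, 'm1) category \<Rightarrow> ('o2, 'm2) category \<Rightarrow> bool" where
  "equivalent_categories C D \<longleftrightarrow> is_category C \<and> is_category D \<and>
    (\<exists>F G. is_functor C D F \<and> is_functor D C G \<and>
      naturally_isomorphic C C (functor_comp F G) id_functor \<and>
      naturally_isomorphic D D (functor_comp G F) id_functor)"


section \<open>Continuous domains\<close>

text \<open>A poset is its order relation \<open>r\<close>, as in \<^theory>\<open>HOL.Order_Relation\<close>; its set of elements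
  is \<^term>\<open>Field r\<close>.\<close>

definition is_lub :: "'a rel \<Rightarrow> 'a set \<Rightarrow> 'a \<Rightarrow> bool" where
  "is_lub r X s \<longleftrightarrow> s \<in> Field r \<and> (\<forall>x\<in>X. (x, s) \<in> r) \<and>
    (\<forall>u\<in>Field r. (\<forall>x\<in>X. (x, u) \<in> r) \<longrightarrow> (s, u) \<in> r)"

definition directed :: "'a rel \<Rightarrow> 'a set \<Rightarrow> bool" where
  "directed r D \<longleftrightarrow> D \<subseteq> Field r \<and> D \<noteq> {} \<and>
    (\<forall>x\<in>D. \<forall>y\<in>D. \<exists>z\<in>D. (x, z) \<in> r \<and> (y, z) \<in> r)"

definition dcpo :: "'a rel \<Rightarrow> bool" where
  "dcpo r \<longleftrightarrow> Partial_order r \<and> (\<forall>D. directed r D \<longrightarrow> (\<exists>s. is_lub r D s))"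

definition way_below :: "'a rel \<Rightarrow> 'a \<Rightarrow> 'a \<Rightarrow> bool" where
  "way_below r x y \<longleftrightarrow> x \<in> Field r \<and> y \<in> Field r \<and>
    (\<forall>D s. directed r D \<and> is_lub r D s \<and> (y, s) \<in> r \<longrightarrow> (\<exists>d\<in>D. (x, d) \<in> r))"

definition domain_basis :: "'a rel \<Rightarrow> 'a set \<Rightarrow> bool" where
  "domain_basis r B \<longleftrightarrow> B \<subseteq> Field r \<and>
    (\<forall>x\<in>Field r. directed r {b\<in>B. way_below r b x} \<and> is_lub r {b\<in>B. way_below r b x} x)"

definition continuous_domain :: "'a rel \<Rightarrow> bool" where
  "continuous_domain r \<longleftrightarrow> dcpo r \<and> (\<exists>B. domain_basis r B)"

text \<open>Scott-continuous functions are taken extensional (\<^term>\<open>undefined\<close> off the source), so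
  that equal morphisms are equal HOL functions.\<close>

definition scott_continuous :: "'a rel \<Rightarrow> 'b rel \<Rightarrow> ('a \<Rightarrow> 'b) \<Rightarrow> bool" where
  "scott_continuous r r' f \<longleftrightarrow> f \<in> Field r \<rightarrow>\<^sub>E Field r' \<and>
    (\<forall>D s. directed r D \<and> is_lub r D s \<longrightarrow> is_lub r' (f ` D) (f s))"

text \<open>Size is controlled by a cardinal \<open>\<kappa>\<close>: contexts have fewer than \<open>\<kappa>\<close> objects and attributes,
  domains have a basis with fewer than \<open>\<kappa>\<close> elements.  Bounding the basis and not the domain
  matters only if \<open>\<kappa>\<close> is not a strong limit (see \<open>small_basis_iff_small_domain\<close> below).

  Posets are nonempty here.  A context has a nonempty selection, so there is an F-morphism
  between any two contexts (lemma \<open>constant_F_morphism\<close>), whereas nothing maps from a nonempty poset to the empty one.\<close>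

definition CD :: "'k rel \<Rightarrow> ('u rel, 'u \<Rightarrow> 'u) category" where
  "CD \<kappa> =
    \<lparr>Ob = {r. continuous_domain r \<and> Field r \<noteq> {} \<and> (\<exists>B. domain_basis r B \<and> |B| <o \<kappa>)},
     Hom = (\<lambda>r r'. {f. scott_continuous r r' f}),
     Ident = (\<lambda>r. restrict (\<lambda>x. x) (Field r)),
     Comp = (\<lambda>r r' r'' f g. compose (Field r) g f)\<rparr>"


section \<open>Attribute continuous formal contexts\<close>

record ('o, 'a) fcontext =
  Objs :: "'o set"
  Attrs :: "'a set"
  Sat :: "('o \<times> 'a) set"
  Ker :: "'a set \<Rightarrow> 'a set"
  Sel :: "'a set set"

definition attrs_of :: "('o, 'a) fcontext \<Rightarrow> 'o set \<Rightarrow> 'a set" where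
  "attrs_of P A = {n \<in> Attrs P. \<forall>m\<in>A. (m, n) \<in> Sat P}"

definition objs_of :: "('o, 'a) fcontext \<Rightarrow> 'a set \<Rightarrow> 'o set" where
  "objs_of P B = {m \<in> Objs P. \<forall>n\<in>B. (m, n) \<in> Sat P}"

abbreviation closure_of :: "('o, 'a) fcontext \<Rightarrow> 'a set \<Rightarrow> 'a set" where
  "closure_of P B \<equiv> attrs_of P (objs_of P B)"

definition br :: "('o, 'a) fcontext \<Rightarrow> 'a set \<Rightarrow> 'a set" where
  "br P B = Ker P (closure_of P B)"

definition kernel_attribute_operator :: "('o, 'a) fcontext \<Rightarrow> bool" where
  "kernel_attribute_operator P \<longleftrightarrow>
    Ker P \<in> Pow (Attrs P) \<rightarrow>\<^sub>E Pow (Attrs P) \<and>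
    (\<forall>B. B \<subseteq> Attrs P \<longrightarrow> Ker P (closure_of P B) \<subseteq> closure_of P B) \<and>
    (\<forall>B. B \<subseteq> Attrs P \<longrightarrow> Ker P (Ker P (closure_of P B)) = Ker P (closure_of P B)) \<and>
    (\<forall>B B1. B \<subseteq> B1 \<and> B1 \<subseteq> Attrs P \<longrightarrow> Ker P (closure_of P B) \<subseteq> Ker P (closure_of P B1))"

definition consistent_selection :: "('o, 'a) fcontext \<Rightarrow> bool" where
  "consistent_selection P \<longleftrightarrow> Sel P \<noteq> {} \<and>
    (\<forall>F\<in>Sel P. finite F \<and> F \<noteq> {} \<and> F \<subseteq> Attrs P) \<and>
    (\<forall>F\<in>Sel P. \<forall>M. finite M \<and> M \<subseteq> br P F \<longrightarrow>
      (\<exists>G\<in>Sel P. M \<subseteq> br P G \<and> G \<subseteq> br P F))"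

definition attribute_continuous :: "('o, 'a) fcontext \<Rightarrow> bool" where
  "attribute_continuous P \<longleftrightarrow> Sat P \<subseteq> Objs P \<times> Attrs P \<and>
    kernel_attribute_operator P \<and> consistent_selection P"

definition rel_all :: "'a set \<Rightarrow> ('a set \<times> 'b) set \<Rightarrow> 'b set \<Rightarrow> bool" where
  "rel_all F H X \<longleftrightarrow> (\<forall>x\<in>X. (F, x) \<in> H)"

definition AR1 :: "('o, 'a) fcontext \<Rightarrow> ('p, 'b) fcontext \<Rightarrow> ('a set \<times> 'b) set \<Rightarrow> bool" where
  "AR1 P Q H \<longleftrightarrow> (\<forall>F\<in>Sel P. \<forall>F'\<in>Sel Q. \<forall>x'\<in>Attrs Q.
    rel_all F H F' \<and> x' \<in> br Q F' \<longrightarrow> (F, x') \<in> H)"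

definition AR2 :: "('o, 'a) fcontext \<Rightarrow> ('p, 'b) fcontext \<Rightarrow> ('a set \<times> 'b) set \<Rightarrow> bool" where
  "AR2 P Q H \<longleftrightarrow> (\<forall>F\<in>Sel P. \<forall>G\<in>Sel P. \<forall>x'\<in>Attrs Q.
    G \<subseteq> br P F \<and> (G, x') \<in> H \<longrightarrow> (F, x') \<in> H)"

definition AR3 :: "('o, 'a) fcontext \<Rightarrow> ('p, 'b) fcontext \<Rightarrow> ('a set \<times> 'b) set \<Rightarrow> bool" where
  "AR3 P Q H \<longleftrightarrow> (\<forall>F\<in>Sel P. \<forall>M'. finite M' \<and> M' \<subseteq> Attrs Q \<and> rel_all F H M' \<longrightarrow>
    (\<exists>K'\<in>Sel Q. M' \<subseteq> K' \<and> rel_all F H K'))"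

definition AR3_br :: "('o, 'a) fcontext \<Rightarrow> ('p, 'b) fcontext \<Rightarrow> ('a set \<times> 'b) set \<Rightarrow> bool" where
  "AR3_br P Q H \<longleftrightarrow> (\<forall>F\<in>Sel P. \<forall>M'. finite M' \<and> M' \<subseteq> Attrs Q \<and> rel_all F H M' \<longrightarrow>
    (\<exists>K'\<in>Sel Q. M' \<subseteq> br Q K' \<and> rel_all F H K'))"

definition AR4 :: "('o, 'a) fcontext \<Rightarrow> ('p, 'b) fcontext \<Rightarrow> ('a set \<times> 'b) set \<Rightarrow> bool" where
  "AR4 P Q H \<longleftrightarrow> (\<forall>F\<in>Sel P. \<forall>x'\<in>Attrs Q. (F, x') \<in> H \<longrightarrow>
    (\<exists>K\<in>Sel P. \<exists>K'\<in>Sel Q. K \<subseteq> br P F \<and> x' \<in> br Q K' \<and> rel_all K H K'))"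

text \<open>With \<^const>\<open>AR3\<close> the identity relation of a context need not be a morphism (lemma
  \<open>ident_not_strict_morphism\<close>), so the attribute continuous formal contexts do not form a category.
  There are two remedies: weaken \<open>M' \<subseteq> K'\<close> to \<open>M' \<subseteq> \<lceil>K'\<rceil>\<close>, as in \<^const>\<open>AR3_br\<close>, and keep all
  contexts; or keep \<^const>\<open>AR3\<close> and only those contexts whose identity is a morphism.  On the latter
  contexts the two kinds of morphism coincide (lemma \<open>strict_F_morphism_iff\<close>), so the second
  category is a full subcategory of the first.\<close>

definition F_morphism :: "('o, 'a) fcontext \<Rightarrow> ('p, 'b) fcontext \<Rightarrow> ('a set \<times> 'b) set \<Rightarrow> bool" where
  "F_morphism P Q H \<longleftrightarrow> H \<subseteq> Sel P \<times> Attrs Q \<and> AR1 P Q H \<and> AR2 P Q H \<and> AR3_br P Q H \<and> AR4 P Q H"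

definition strict_F_morphism ::
  "('o, 'a) fcontext \<Rightarrow> ('p, 'b) fcontext \<Rightarrow> ('a set \<times> 'b) set \<Rightarrow> bool" where
  "strict_F_morphism P Q H \<longleftrightarrow>
    H \<subseteq> Sel P \<times> Attrs Q \<and> AR1 P Q H \<and> AR2 P Q H \<and> AR3 P Q H \<and> AR4 P Q H"

definition F_ident :: "('o, 'a) fcontext \<Rightarrow> ('a set \<times> 'a) set" where
  "F_ident P = {(F, x). F \<in> Sel P \<and> x \<in> Attrs P \<and> x \<in> br P F}"

definition F_comp ::
  "('o, 'a) fcontext \<Rightarrow> ('p, 'b) fcontext \<Rightarrow> ('q, 'c) fcontext \<Rightarrow>
    ('a set \<times> 'b) set \<Rightarrow> ('b set \<times> 'c) set \<Rightarrow> ('a set \<times> 'c) set" where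
  "F_comp P Q R H H' = {(F, x). F \<in> Sel P \<and> x \<in> Attrs R \<and>
    (\<exists>G\<in>Sel Q. rel_all F H G \<and> (G, x) \<in> H')}"

definition ACC :: "'k rel \<Rightarrow> (('u, 'u) fcontext, ('u set \<times> 'u) set) category" where
  "ACC \<kappa> =
    \<lparr>Ob = {P. attribute_continuous P \<and> |Objs P| <o \<kappa> \<and> |Attrs P| <o \<kappa>},
     Hom = (\<lambda>P Q. {H. F_morphism P Q H}),
     Ident = F_ident,
     Comp = F_comp\<rparr>"

definition strict_ACC :: "'k rel \<Rightarrow> (('u, 'u) fcontext, ('u set \<times> 'u) set) category" where
  "strict_ACC \<kappa> =
    \<lparr>Ob = {P. attribute_continuous P \<and> strict_F_morphism P P (F_ident P) \<and>
       |Objs P| <o \<kappa> \<and> |Attrs P| <o \<kappa>},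
     Hom = (\<lambda>P Q. {H. strict_F_morphism P Q H}),
     Ident = F_ident,
     Comp = F_comp\<rparr>"


section \<open>The two versions of the third condition\<close>

lemma br_mono:
  assumes "kernel_attribute_operator P" "B \<subseteq> B1" "B1 \<subseteq> Attrs P"
  shows "br P B \<subseteq> br P B1"
  using assms unfolding kernel_attribute_operator_def br_def by blast

lemma br_subset_Attrs:
  assumes "kernel_attribute_operator P" "B \<subseteq> Attrs P"
  shows "br P B \<subseteq> Attrs P"
proof -
  have "br P B \<subseteq> closure_of P B"
    using assms by (simp add: kernel_attribute_operator_def br_def)
  also have "\<dots> \<subseteq> Attrs P" by (auto simp: attrs_of_def)
  finally show ?thesis .
qed

lemma AR3_imp_AR3_br:
  assumes Q: "attribute_continuous Q" and H: "H \<subseteq> Sel P \<times> Attrs Q"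
    and 2: "AR2 P Q H" and 3: "AR3 P Q H" and 4: "AR4 P Q H"
  shows "AR3_br P Q H"
  unfolding AR3_br_def
proof (intro ballI allI impI)
  fix F M' assume F: "F \<in> Sel P" and M': "finite M' \<and> M' \<subseteq> Attrs Q \<and> rel_all F H M'"
  have "\<exists>K'\<in>Sel Q. x \<in> br Q K' \<and> rel_all F H K'" if x: "x \<in> M'" for x
  proof -
    have "(F, x) \<in> H" "x \<in> Attrs Q" using x M' by (auto simp: rel_all_def)
    with 4 F obtain K K' where K: "K \<in> Sel P" "K' \<in> Sel Q" "K \<subseteq> br P F" "x \<in> br Q K'" "rel_all K H K'"
      unfolding AR4_def by blast
    have "rel_all F H K'"
      using 2 F K H unfolding AR2_def rel_all_def by blast
    then show ?thesis using K by blast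
  qed
  then obtain k where k: "\<And>x. x \<in> M' \<Longrightarrow> k x \<in> Sel Q \<and> x \<in> br Q (k x) \<and> rel_all F H (k x)"
    by metis
  have sel: "\<And>K. K \<in> Sel Q \<Longrightarrow> finite K \<and> K \<subseteq> Attrs Q"
    and ker: "kernel_attribute_operator Q"
    using Q unfolding attribute_continuous_def consistent_selection_def by blast+
  have "finite (\<Union>(k ` M')) \<and> \<Union>(k ` M') \<subseteq> Attrs Q \<and> rel_all F H (\<Union>(k ` M'))"
    using k sel M' by (fastforce simp: rel_all_def)
  with 3 F obtain K' where K': "K' \<in> Sel Q" "\<Union>(k ` M') \<subseteq> K'" "rel_all F H K'"
    unfolding AR3_def by meson
  have "M' \<subseteq> br Q K'"
  proof
    fix x assume x: "x \<in> M'"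
    have "br Q (k x) \<subseteq> br Q K'"
      by (rule br_mono[OF ker]) (use x K' sel in auto)
    then show "x \<in> br Q K'" using k x by blast
  qed
  with K' show "\<exists>K'\<in>Sel Q. M' \<subseteq> br Q K' \<and> rel_all F H K'" by blast
qed

lemma AR3_br_imp_AR3:
  assumes Q: "attribute_continuous Q" and I: "strict_F_morphism Q Q (F_ident Q)"
    and 1: "AR1 P Q H" and 3: "AR3_br P Q H"
  shows "AR3 P Q H"
  unfolding AR3_def
proof (intro ballI allI impI)
  fix F M' assume F: "F \<in> Sel P" and M': "finite M' \<and> M' \<subseteq> Attrs Q \<and> rel_all F H M'"
  with 3 obtain K where K: "K \<in> Sel Q" "M' \<subseteq> br Q K" "rel_all F H K"
    unfolding AR3_br_def by blast
  have "rel_all K (F_ident Q) M'" using K M' by (auto simp: rel_all_def F_ident_def)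
  with I K M' obtain K' where K': "K' \<in> Sel Q" "M' \<subseteq> K'" "rel_all K (F_ident Q) K'"
    unfolding strict_F_morphism_def AR3_def by blast
  have "rel_all F H K'"
    using 1 F K K' unfolding AR1_def rel_all_def F_ident_def by blast
  with K' show "\<exists>K'\<in>Sel Q. M' \<subseteq> K' \<and> rel_all F H K'" by blast
qed

lemma strict_F_morphism_iff:
  assumes "attribute_continuous Q" "strict_F_morphism Q Q (F_ident Q)"
  shows "strict_F_morphism P Q H \<longleftrightarrow> F_morphism P Q H"
  using AR3_imp_AR3_br[OF assms(1)] AR3_br_imp_AR3[OF assms]
  unfolding strict_F_morphism_def F_morphism_def by blast

text \<open>One object having two attributes, the identity kernel operator and the single
  selected set \<open>{True}\<close>: then \<open>\<lceil>{True}\<rceil> = {True, False}\<close>, but no selected set contains \<open>False\<close>.\<close>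

definition cex :: "(unit, bool) fcontext" where
  "cex = \<lparr>Objs = UNIV, Attrs = UNIV, Sat = UNIV, Ker = (\<lambda>B. B), Sel = {{True}}\<rparr>"

lemma cex_attribute_continuous: "attribute_continuous cex"
  by (simp add: attribute_continuous_def kernel_attribute_operator_def consistent_selection_def
      cex_def br_def attrs_of_def)

lemma ident_not_strict_morphism: "\<not> strict_F_morphism cex cex (F_ident cex)"
proof
  assume "strict_F_morphism cex cex (F_ident cex)"
  then have "AR3 cex cex (F_ident cex)" by (simp add: strict_F_morphism_def)
  moreover have "rel_all {True} (F_ident cex) {False}"
    by (simp add: rel_all_def F_ident_def cex_def br_def attrs_of_def)
  ultimately have "\<exists>K'\<in>Sel cex. {False} \<subseteq> K'"
    unfolding AR3_def by (force simp: cex_def)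
  then show False by (simp add: cex_def)
qed


text \<open>Hom-sets are never empty; this is why the empty poset has no counterpart among contexts.\<close>

lemma constant_F_morphism:
  assumes P: "attribute_continuous P" and Q: "attribute_continuous Q" and K0: "K0 \<in> Sel Q"
  shows "F_morphism P Q (Sel P \<times> br Q K0)"
proof -
  have selP: "\<And>F. F \<in> Sel P \<Longrightarrow> \<exists>K\<in>Sel P. K \<subseteq> br P F"
    using P unfolding attribute_continuous_def consistent_selection_def
    by (metis empty_subsetI finite.emptyI)
  have kerQ: "kernel_attribute_operator Q" and selQ: "\<And>K. K \<in> Sel Q \<Longrightarrow> K \<subseteq> Attrs Q"
    using Q unfolding attribute_continuous_def consistent_selection_def by blast+
  have conQ: "\<And>M. finite M \<Longrightarrow> M \<subseteq> br Q K0 \<Longrightarrow> \<exists>G\<in>Sel Q. M \<subseteq> br Q G \<and> G \<subseteq> br Q K0"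
    using Q K0 by (simp add: attribute_continuous_def consistent_selection_def)
  have sub: "br Q K0 \<subseteq> Attrs Q" by (rule br_subset_Attrs[OF kerQ selQ[OF K0]])
  have closed: "br Q G \<subseteq> br Q K0" if "G \<subseteq> br Q K0" for G
  proof -
    have c: "closure_of Q K0 \<subseteq> Attrs Q" "br Q K0 \<subseteq> closure_of Q K0"
      using kerQ selQ[OF K0] by (auto simp: kernel_attribute_operator_def br_def attrs_of_def[of Q])
    have "br Q G \<subseteq> br Q (closure_of Q K0)"
      by (rule br_mono[OF kerQ]) (use that c in blast)+
    moreover have "closure_of Q (closure_of Q K0) = closure_of Q K0"
      using selQ[OF K0] unfolding attrs_of_def objs_of_def by blast
    then have "br Q (closure_of Q K0) = br Q K0" by (simp add: br_def)
    ultimately show ?thesis by simp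
  qed
  have all: "rel_all F (Sel P \<times> br Q K0) X \<longleftrightarrow> X \<subseteq> br Q K0" if "F \<in> Sel P" for F X
    using that by (auto simp: rel_all_def)
  have "AR1 P Q (Sel P \<times> br Q K0)" unfolding AR1_def using all closed by blast
  moreover have "AR2 P Q (Sel P \<times> br Q K0)" unfolding AR2_def by blast
  moreover have "AR3_br P Q (Sel P \<times> br Q K0)" by (simp add: AR3_br_def all conQ)
  moreover have "AR4 P Q (Sel P \<times> br Q K0)" unfolding AR4_def
  proof (intro ballI impI)
    fix F x' assume F: "F \<in> Sel P" and x: "(F, x') \<in> Sel P \<times> br Q K0"
    obtain K where K: "K \<in> Sel P" "K \<subseteq> br P F" using selP[OF F] by blast
    obtain K' where "K' \<in> Sel Q" "x' \<in> br Q K'" "K' \<subseteq> br Q K0"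
      using conQ[of "{x'}"] x by auto
    with K all[OF K(1)] show "\<exists>K\<in>Sel P. \<exists>K'\<in>Sel Q. K \<subseteq> br P F \<and> x' \<in> br Q K' \<and>
        rel_all K (Sel P \<times> br Q K0) K'"
      by metis
  qed
  moreover have "Sel P \<times> br Q K0 \<subseteq> Sel P \<times> Attrs Q" using sub by (rule Sigma_mono[OF subset_refl])
  ultimately show ?thesis by (simp only: F_morphism_def simp_thms)
qed


section \<open>Size bounds\<close>

text \<open>If \<open>\<kappa>\<close> is a strong limit, the small domains are those with fewer than \<open>\<kappa>\<close> elements.\<close>

lemma small_basis_iff_small_domain:
  fixes r :: "'u rel"
  assumes sl: "\<And>A::'u set. |A| <o \<kappa> \<Longrightarrow> |Pow A| <o \<kappa>" and r: "continuous_domain r"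
  shows "(\<exists>B. domain_basis r B \<and> |B| <o \<kappa>) \<longleftrightarrow> |Field r| <o \<kappa>"
proof
  assume "\<exists>B. domain_basis r B \<and> |B| <o \<kappa>"
  then obtain B where B: "domain_basis r B" "|B| <o \<kappa>" by blast
  have an: "antisym r"
    using r by (simp add: continuous_domain_def dcpo_def partial_order_on_def)
  let ?f = "\<lambda>x. {b\<in>B. way_below r b x}"
  have "inj_on ?f (Field r)"
  proof (rule inj_onI)
    fix x y assume xy: "x \<in> Field r" "y \<in> Field r" "?f x = ?f y"
    then have "is_lub r (?f x) x" "is_lub r (?f x) y"
      using B(1) unfolding domain_basis_def by metis+
    then have "(x, y) \<in> r" "(y, x) \<in> r" using xy unfolding is_lub_def by blast+
    then show "x = y" using an by (simp add: antisym_def)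
  qed
  then have "|Field r| \<le>o |Pow B|"
    by (rule card_of_ordLeqI) auto
  then show "|Field r| <o \<kappa>" using sl[OF B(2)] by (rule ordLeq_ordLess_trans)
next
  assume F: "|Field r| <o \<kappa>"
  obtain B where "domain_basis r B" using r by (auto simp: continuous_domain_def)
  moreover from this have "|B| \<le>o |Field r|"
    by (intro card_of_mono1) (simp add: domain_basis_def)
  ultimately show "\<exists>B. domain_basis r B \<and> |B| <o \<kappa>"
    using F ordLeq_ordLess_trans by blast
qed

text \<open>The size hypotheses of the theorem hold for \<open>'u = 'd set\<close> and \<open>\<kappa>\<close> the successor cardinal of
  an infinite type \<open>'d\<close>.  Since \<open>x \<mapsto> {x}\<close> embeds \<open>'d\<close> into \<open>'d set\<close>, every continuous domain on
  \<open>'d\<close> is then covered up to isomorphism.\<close>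

lemma size_hypotheses_cardSuc:
  assumes "infinite (UNIV :: 'd set)"
  shows "Cinfinite (cardSuc |UNIV :: 'd set| )"
    and "|A :: 'd set set| <o cardSuc |UNIV :: 'd set| \<Longrightarrow> |Pow A| \<le>o |UNIV :: 'd set set|"
    and "|B :: 'd set| <o cardSuc |UNIV :: 'd set|"
proof -
  show "Cinfinite (cardSuc |UNIV :: 'd set| )"
    using assms by (intro Cinfinite_cardSuc conjI card_of_Card_order) (simp add: cinfinite_def Field_card_of)
  have le: "( |X| <o cardSuc |UNIV :: 'd set| ) = ( |X| \<le>o |UNIV :: 'd set| )" for X :: "'x set"
    by (rule card_of_Card_order cardSuc_ordLeq_ordLess)+
  show "|B :: 'd set| <o cardSuc |UNIV :: 'd set|"
    by (simp add: le card_of_mono1)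
  assume "|A :: 'd set set| <o cardSuc |UNIV :: 'd set|"
  then have "|A| \<le>o |UNIV :: 'd set|" by (simp add: le)
  then obtain f :: "'d set \<Rightarrow> 'd" where f: "inj_on f A"
    by (auto simp: card_of_ordLeq[symmetric])
  show "|Pow A| \<le>o |UNIV :: 'd set set|"
    by (rule card_of_ordLeqI[of "image f"]) (use f in \<open>simp_all add: inj_on_image_Pow\<close>)
qed

end

(* A context is determined up to isomorphism by its points, the rounded ideals of the relation
   "F is contained in the bracket of G" on selected sets.  Ordered by inclusion they are closed
   under directed unions, and the brackets of the selected sets form a basis, so the points form a
   continuous domain.  An F-morphism H is the same thing as a map between points preserving directed
   unions: it sends X to the set of all x with (F, x) in H for some selected F contained in X, and
   H is recovered from the values of this map on the brackets.  Composition of F-morphisms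
   corresponds to composition of maps, so taking points is a fully faithful functor, and the category
   laws for contexts follow from those for functions.  Conversely, a domain with basis B is isomorphic
   to the points of a context with attribute set B, with bracket the set of basis elements way below,
   and with the finite sets having a greatest element selected; the identity of this context satisfies
   the strong form of (AR3). *)

theory Submission
  imports Defs
begin

text \<open>Two facts shape the argument. First, a selected set \<open>F\<close> need not lie in its
  own bracket, so it has to be shown that a morphism depends on \<open>F\<close> only through the
  point \<open>br P F\<close>; this is the work of (AR4), with (AR2) for the converse. Second,
  selected sets are finite, and a finite set inside a directed union lies in a single member. This
  yields closure of the points under directed unions, continuity of the maps induced by morphisms,
  and the fact that brackets approximate points. Points are subsets of \<open>'u\<close>, whereas
  objects of \<open>CD\<close> are orders on \<open>'u\<close> itself, and by Cantor no injection
  encodes all subsets at once. The power-set hypothesis supplies one injection per context. That the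
  cardinal is infinite enters when finite sets of attributes are counted, which bounds the basis of
  brackets. Both versions of the category are treated together: on strict contexts the two notions
  of morphism agree, and every domain already comes from a strict context.\<close>

section \<open>Faithful functors and equivalences of abstract categories\<close>

text \<open>Unit and associativity laws are equations between parallel morphisms, so an injective
  action on hom-sets reflects them from \<open>D\<close>. Closure under identities and composition
  is not of this kind and is assumed.\<close>

lemma is_category_of_faithful_functor:
  assumes D: "is_category D" and F: "is_functor C D F"
    and id: "\<And>X. X \<in> Ob C \<Longrightarrow> Ident C X \<in> Hom C X X"
    and comp: "\<And>X Y Z f g. X \<in> Ob C \<Longrightarrow> Y \<in> Ob C \<Longrightarrow> Z \<in> Ob C \<Longrightarrow> f \<in> Hom C X Y \<Longrightarrow>
      g \<in> Hom C Y Z \<Longrightarrow> Comp C X Y Z f g \<in> Hom C X Z"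
    and faithful: "\<And>X Y. X \<in> Ob C \<Longrightarrow> Y \<in> Ob C \<Longrightarrow> inj_on (on_hom F X Y) (Hom C X Y)"
  shows "is_category C"
proof -
  have Fo: "\<And>X. X \<in> Ob C \<Longrightarrow> on_ob F X \<in> Ob D"
    and Fh: "\<And>X Y f. X \<in> Ob C \<Longrightarrow> Y \<in> Ob C \<Longrightarrow> f \<in> Hom C X Y \<Longrightarrow>
      on_hom F X Y f \<in> Hom D (on_ob F X) (on_ob F Y)"
    and Fid: "\<And>X. X \<in> Ob C \<Longrightarrow> on_hom F X X (Ident C X) = Ident D (on_ob F X)"
    and Fc: "\<And>X Y Z f g. X \<in> Ob C \<Longrightarrow> Y \<in> Ob C \<Longrightarrow> Z \<in> Ob C \<Longrightarrow> f \<in> Hom C X Y \<Longrightarrow>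
      g \<in> Hom C Y Z \<Longrightarrow> on_hom F X Z (Comp C X Y Z f g) =
        Comp D (on_ob F X) (on_ob F Y) (on_ob F Z) (on_hom F X Y f) (on_hom F Y Z g)"
    using F unfolding is_functor_def by blast+
  have Did: "\<And>X Y f. X \<in> Ob D \<Longrightarrow> Y \<in> Ob D \<Longrightarrow> f \<in> Hom D X Y \<Longrightarrow>
      Comp D X X Y (Ident D X) f = f \<and> Comp D X Y Y f (Ident D Y) = f"
    and Das: "\<And>W X Y Z f g h. W \<in> Ob D \<Longrightarrow> X \<in> Ob D \<Longrightarrow> Y \<in> Ob D \<Longrightarrow> Z \<in> Ob D \<Longrightarrow>
      f \<in> Hom D W X \<Longrightarrow> g \<in> Hom D X Y \<Longrightarrow> h \<in> Hom D Y Z \<Longrightarrow>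
      Comp D W Y Z (Comp D W X Y f g) h = Comp D W X Z f (Comp D X Y Z g h)"
    using D unfolding is_category_def by blast+
  show ?thesis
    unfolding is_category_def
  proof (intro conjI ballI)
    fix X Y f assume [simp]: "X \<in> Ob C" "Y \<in> Ob C" "f \<in> Hom C X Y"
    show "Comp C X X Y (Ident C X) f = f"
      by (rule inj_onD[OF faithful[of X Y]]) (simp_all add: id comp Fc Fid Fh Fo Did)
    show "Comp C X Y Y f (Ident C Y) = f"
      by (rule inj_onD[OF faithful[of X Y]]) (simp_all add: id comp Fc Fid Fh Fo Did)
  next
    fix W X Y Z f g h
    assume [simp]: "W \<in> Ob C" "X \<in> Ob C" "Y \<in> Ob C" "Z \<in> Ob C"
      "f \<in> Hom C W X" "g \<in> Hom C X Y" "h \<in> Hom C Y Z"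
    have [simp]: "Comp C W X Y f g \<in> Hom C W Y" "Comp C X Y Z g h \<in> Hom C X Z"
      by (auto intro: comp[of W X Y] comp[of X Y Z])
    show "Comp C W Y Z (Comp C W X Y f g) h = Comp C W X Z f (Comp C X Y Z g h)"
    proof (rule inj_onD[OF faithful[of W Z]])
      show "Comp C W Y Z (Comp C W X Y f g) h \<in> Hom C W Z"
        by (rule comp[of W Y Z]) simp_all
      show "Comp C W X Z f (Comp C X Y Z g h) \<in> Hom C W Z"
        by (rule comp[of W X Z]) simp_all
    qed (simp_all add: Fc Fh Fo Das)
  qed (auto intro: id comp)
qed

text \<open>Full faithfulness lets each morphism between images be pulled back uniquely. The
  quasi-inverse picks for each \<open>Y\<close> an object \<open>G0 Y\<close> whose image is
  isomorphic to \<open>Y\<close>, conjugates morphisms of \<open>D\<close> by these isomorphisms and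
  pulls the result back.\<close>

lemma equivalence_criterion:
  assumes C: "is_category C" and D: "is_category D" and F: "is_functor C D F"
    and ff: "\<And>X Y. X \<in> Ob C \<Longrightarrow> Y \<in> Ob C \<Longrightarrow>
      bij_betw (on_hom F X Y) (Hom C X Y) (Hom D (on_ob F X) (on_ob F Y))"
    and es: "\<And>Y. Y \<in> Ob D \<Longrightarrow> \<exists>X\<in>Ob C. \<exists>f. isomorphism D Y (on_ob F X) f"
  shows "equivalent_categories C D"
proof -
  have Fo [simp]: "\<And>X. X \<in> Ob C \<Longrightarrow> on_ob F X \<in> Ob D"
    and Fh [simp]: "\<And>X Y f. X \<in> Ob C \<Longrightarrow> Y \<in> Ob C \<Longrightarrow> f \<in> Hom C X Y \<Longrightarrow>
      on_hom F X Y f \<in> Hom D (on_ob F X) (on_ob F Y)"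
    and Fid [simp]: "\<And>X. X \<in> Ob C \<Longrightarrow> on_hom F X X (Ident C X) = Ident D (on_ob F X)"
    and Fc: "\<And>X Y Z f g. X \<in> Ob C \<Longrightarrow> Y \<in> Ob C \<Longrightarrow> Z \<in> Ob C \<Longrightarrow> f \<in> Hom C X Y \<Longrightarrow>
      g \<in> Hom C Y Z \<Longrightarrow> on_hom F X Z (Comp C X Y Z f g) =
        Comp D (on_ob F X) (on_ob F Y) (on_ob F Z) (on_hom F X Y f) (on_hom F Y Z g)"
    using F unfolding is_functor_def by blast+
  have Cid [simp]: "\<And>X. X \<in> Ob C \<Longrightarrow> Ident C X \<in> Hom C X X"
    and Cco [simp]: "\<And>X Y Z f g. X \<in> Ob C \<Longrightarrow> Y \<in> Ob C \<Longrightarrow> Z \<in> Ob C \<Longrightarrow> f \<in> Hom C X Y \<Longrightarrow>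
      g \<in> Hom C Y Z \<Longrightarrow> Comp C X Y Z f g \<in> Hom C X Z"
    using C unfolding is_category_def by blast+
  have Did [simp]: "\<And>X. X \<in> Ob D \<Longrightarrow> Ident D X \<in> Hom D X X"
    and Dco [simp]: "\<And>X Y Z f g. X \<in> Ob D \<Longrightarrow> Y \<in> Ob D \<Longrightarrow> Z \<in> Ob D \<Longrightarrow> f \<in> Hom D X Y \<Longrightarrow>
      g \<in> Hom D Y Z \<Longrightarrow> Comp D X Y Z f g \<in> Hom D X Z"
    and Dl [simp]: "\<And>X Y f. X \<in> Ob D \<Longrightarrow> Y \<in> Ob D \<Longrightarrow> f \<in> Hom D X Y \<Longrightarrow> Comp D X X Y (Ident D X) f = f"
    and Dr [simp]: "\<And>X Y f. X \<in> Ob D \<Longrightarrow> Y \<in> Ob D \<Longrightarrow> f \<in> Hom D X Y \<Longrightarrow> Comp D X Y Y f (Ident D Y) = f"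
    and Das: "\<And>W X Y Z f g h. W \<in> Ob D \<Longrightarrow> X \<in> Ob D \<Longrightarrow> Y \<in> Ob D \<Longrightarrow> Z \<in> Ob D \<Longrightarrow>
      f \<in> Hom D W X \<Longrightarrow> g \<in> Hom D X Y \<Longrightarrow> h \<in> Hom D Y Z \<Longrightarrow>
      Comp D W Y Z (Comp D W X Y f g) h = Comp D W X Z f (Comp D X Y Z g h)"
    using D unfolding is_category_def by blast+
  \<comment> \<open>The two directions of the isomorphism are swapped, so that the chosen
    \<open>e Y\<close> runs from \<open>on_ob F (G0 Y)\<close> to \<open>Y\<close>, towards the
    identity functor.\<close>
  have "\<forall>Y\<in>Ob D. \<exists>X f g. X \<in> Ob C \<and> f \<in> Hom D (on_ob F X) Y \<and> g \<in> Hom D Y (on_ob F X) \<and>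
      Comp D (on_ob F X) Y (on_ob F X) f g = Ident D (on_ob F X) \<and>
      Comp D Y (on_ob F X) Y g f = Ident D Y"
    using es unfolding isomorphism_def by meson
  then obtain G0 e e' where
    G0 [simp]: "\<And>Y. Y \<in> Ob D \<Longrightarrow> G0 Y \<in> Ob C"
    and e [simp]: "\<And>Y. Y \<in> Ob D \<Longrightarrow> e Y \<in> Hom D (on_ob F (G0 Y)) Y"
    and e' [simp]: "\<And>Y. Y \<in> Ob D \<Longrightarrow> e' Y \<in> Hom D Y (on_ob F (G0 Y))"
    and ee' [simp]: "\<And>Y. Y \<in> Ob D \<Longrightarrow>
      Comp D (on_ob F (G0 Y)) Y (on_ob F (G0 Y)) (e Y) (e' Y) = Ident D (on_ob F (G0 Y))"
    and e'e [simp]: "\<And>Y. Y \<in> Ob D \<Longrightarrow> Comp D Y (on_ob F (G0 Y)) Y (e' Y) (e Y) = Ident D Y"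
    by metis
  define inv where "inv X Y = inv_into (Hom C X Y) (on_hom F X Y)" for X Y
  have invh [simp]: "inv X Y f \<in> Hom C X Y" and Finv [simp]: "on_hom F X Y (inv X Y f) = f"
    if "X \<in> Ob C" "Y \<in> Ob C" "f \<in> Hom D (on_ob F X) (on_ob F Y)" for X Y f
    using ff[OF that(1,2)] that(3) unfolding inv_def bij_betw_def
    by (auto intro: inv_into_into f_inv_into_f)
  have faith: "f = g" if "X \<in> Ob C" "Y \<in> Ob C" "f \<in> Hom C X Y" "g \<in> Hom C X Y"
    "on_hom F X Y f = on_hom F X Y g" for X Y f g
    using ff[OF that(1,2)] that(3-) unfolding bij_betw_def inj_on_def by blast
  define conj where "conj X Y f = Comp D (on_ob F (G0 X)) X (on_ob F (G0 Y)) (e X)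
      (Comp D X Y (on_ob F (G0 Y)) f (e' Y))" for X Y f
  have conj [simp]: "conj X Y f \<in> Hom D (on_ob F (G0 X)) (on_ob F (G0 Y))"
    if [simp]: "X \<in> Ob D" "Y \<in> Ob D" "f \<in> Hom D X Y" for X Y f
    unfolding conj_def by (intro Dco; simp)
  \<comment> \<open>Naturality of \<open>e\<close>: the trailing \<open>e' Y\<close> of the
    conjugate cancels against \<open>e Y\<close>. Both natural isomorphisms rest on this
    square.\<close>
  have conj_e: "Comp D (on_ob F (G0 X)) (on_ob F (G0 Y)) Y (conj X Y f) (e Y) =
      Comp D (on_ob F (G0 X)) X Y (e X) f"
    if [simp]: "X \<in> Ob D" "Y \<in> Ob D" "f \<in> Hom D X Y" for X Y f
  proof -
    have [simp]: "Comp D X Y (on_ob F (G0 Y)) f (e' Y) \<in> Hom D X (on_ob F (G0 Y))"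
      by (intro Dco; simp)
    show ?thesis by (simp add: conj_def Das)
  qed
  have conj_comp: "Comp D (on_ob F (G0 X)) (on_ob F (G0 Y)) (on_ob F (G0 Z)) (conj X Y f) (conj Y Z g) =
      conj X Z (Comp D X Y Z f g)"
    if [simp]: "X \<in> Ob D" "Y \<in> Ob D" "Z \<in> Ob D" "f \<in> Hom D X Y" "g \<in> Hom D Y Z" for X Y Z f g
  proof -
    have [simp]: "Comp D Y Z (on_ob F (G0 Z)) g (e' Z) \<in> Hom D Y (on_ob F (G0 Z))"
      by (intro Dco; simp)
    have "Comp D (on_ob F (G0 X)) (on_ob F (G0 Y)) (on_ob F (G0 Z)) (conj X Y f) (conj Y Z g) =
       Comp D (on_ob F (G0 X)) Y (on_ob F (G0 Z))
         (Comp D (on_ob F (G0 X)) (on_ob F (G0 Y)) Y (conj X Y f) (e Y))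
         (Comp D Y Z (on_ob F (G0 Z)) g (e' Z))"
      unfolding conj_def[of Y Z] by (rule Das[symmetric]; simp)
    also have "\<dots> = conj X Z (Comp D X Y Z f g)"
      by (simp add: conj_e conj_def Das)
    finally show ?thesis .
  qed
  define G where "G = \<lparr>on_ob = G0, on_hom = (\<lambda>X Y f. inv (G0 X) (G0 Y) (conj X Y f))\<rparr>"
  have G: "is_functor D C G"
    unfolding is_functor_def
  proof (intro conjI ballI)
    fix X Y Z f g
    assume [simp]: "X \<in> Ob D" "Y \<in> Ob D" "Z \<in> Ob D" "f \<in> Hom D X Y" "g \<in> Hom D Y Z"
    have [simp]: "Comp D X Y Z f g \<in> Hom D X Z" by (rule Dco; simp)
    have *: "Comp C (G0 X) (G0 Y) (G0 Z) (inv (G0 X) (G0 Y) (conj X Y f)) (inv (G0 Y) (G0 Z) (conj Y Z g))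
        \<in> Hom C (G0 X) (G0 Z)" by (rule Cco; simp)
    show "on_hom G X Z (Comp D X Y Z f g) =
      Comp C (on_ob G X) (on_ob G Y) (on_ob G Z) (on_hom G X Y f) (on_hom G Y Z g)"
      unfolding G_def by (simp, rule faith[of "G0 X" "G0 Z"]) (use * in \<open>simp_all add: Fc conj_comp\<close>)
  next
    fix X assume [simp]: "X \<in> Ob D"
    show "on_hom G X X (Ident D X) = Ident C (on_ob G X)"
      unfolding G_def by (simp, rule faith[of "G0 X" "G0 X"]) (simp_all add: conj_def)
  qed (simp_all add: G_def)
  \<comment> \<open>At an object of \<open>C\<close> the component is the pullback of
    \<open>e\<close> at its image; faithfulness reflects the two inverse laws.\<close>
  have "isomorphism C (G0 (on_ob F X)) X (inv (G0 (on_ob F X)) X (e (on_ob F X)))"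
    if [simp]: "X \<in> Ob C" for X
  proof -
    let ?a = "inv (G0 (on_ob F X)) X (e (on_ob F X))"
    let ?b = "inv X (G0 (on_ob F X)) (e' (on_ob F X))"
    have [simp]: "Comp C (G0 (on_ob F X)) X (G0 (on_ob F X)) ?a ?b \<in> Hom C (G0 (on_ob F X)) (G0 (on_ob F X))"
      "Comp C X (G0 (on_ob F X)) X ?b ?a \<in> Hom C X X"
      by (rule Cco; simp)+
    have "Comp C (G0 (on_ob F X)) X (G0 (on_ob F X)) ?a ?b = Ident C (G0 (on_ob F X))"
      by (rule faith[of "G0 (on_ob F X)" "G0 (on_ob F X)"]) (simp_all add: Fc)
    moreover have "Comp C X (G0 (on_ob F X)) X ?b ?a = Ident C X"
      by (rule faith[of X X]) (simp_all add: Fc)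
    ultimately show ?thesis unfolding isomorphism_def by (intro conjI bexI[of _ ?b]) simp_all
  qed
  moreover have "Comp C (G0 (on_ob F X)) (G0 (on_ob F Y)) Y
        (inv (G0 (on_ob F X)) (G0 (on_ob F Y)) (conj (on_ob F X) (on_ob F Y) (on_hom F X Y f)))
        (inv (G0 (on_ob F Y)) Y (e (on_ob F Y))) =
      Comp C (G0 (on_ob F X)) X Y (inv (G0 (on_ob F X)) X (e (on_ob F X))) f"
    (is "?l = ?r")
    if [simp]: "X \<in> Ob C" "Y \<in> Ob C" "f \<in> Hom C X Y" for X Y f
  proof (rule faith[of "G0 (on_ob F X)" Y])
    show "?l \<in> Hom C (G0 (on_ob F X)) Y" "?r \<in> Hom C (G0 (on_ob F X)) Y"
      by (rule Cco; simp)+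
  qed (simp_all add: Fc conj_e)
  ultimately have GF: "naturally_isomorphic C C (functor_comp F G) id_functor"
    unfolding naturally_isomorphic_def
    by (intro exI[of _ "\<lambda>X. inv (G0 (on_ob F X)) X (e (on_ob F X))"])
      (simp add: functor_comp_def id_functor_def G_def)
  have "isomorphism D (on_ob F (G0 Y)) Y (e Y)" if [simp]: "Y \<in> Ob D" for Y
    unfolding isomorphism_def by (intro conjI bexI[of _ "e' Y"]) simp_all
  then have FG: "naturally_isomorphic D D (functor_comp G F) id_functor"
    unfolding naturally_isomorphic_def
    by (intro exI[of _ e]) (simp add: functor_comp_def id_functor_def G_def conj_e)
  from C D F G GF FG show ?thesis
    unfolding equivalent_categories_def by blast
qed

section \<open>Continuous domains\<close>

lemma is_lub_unique: "antisym r \<Longrightarrow> is_lub r D s \<Longrightarrow> is_lub r D t \<Longrightarrow> s = t"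
  unfolding is_lub_def antisym_def by blast

text \<open>Monotonicity is not part of the definition: it comes from preserving the least upper
  bound \<open>y\<close> of the directed pair \<open>{x, y}\<close>.\<close>

lemma scott_continuous_mono:
  assumes r: "Partial_order r" and f: "scott_continuous r r' f" and xy: "(x, y) \<in> r"
  shows "(f x, f y) \<in> r'"
proof -
  have F: "x \<in> Field r" "y \<in> Field r" using xy by (auto simp: Field_def)
  have refl: "(y, y) \<in> r" "(x, x) \<in> r" using r F by (auto simp: order_on_defs refl_on_def)
  have "directed r {x, y}" "is_lub r {x, y} y"
    using F refl xy unfolding directed_def is_lub_def by blast+
  then have "is_lub r' (f ` {x, y}) (f y)" using f unfolding scott_continuous_def by blast
  then show ?thesis by (simp add: is_lub_def)
qed

lemma scott_continuous_directed_image: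
  assumes "Partial_order r" and f: "scott_continuous r r' f" and D: "directed r D"
  shows "directed r' (f ` D)"
proof -
  have "f ` D \<subseteq> Field r'" using f D by (auto simp: scott_continuous_def directed_def)
  then show ?thesis using D scott_continuous_mono[OF assms(1,2)] unfolding directed_def by (simp, metis)
qed

lemma scott_continuous_compose:
  assumes "Partial_order r" and f: "scott_continuous r r' f" and g: "scott_continuous r' r'' g"
  shows "scott_continuous r r'' (compose (Field r) g f)"
  unfolding scott_continuous_def
proof (intro conjI allI impI)
  have "f \<in> Field r \<rightarrow> Field r'" "g \<in> Field r' \<rightarrow> Field r''"
    using f g by (auto simp: scott_continuous_def)
  then show "compose (Field r) g f \<in> Field r \<rightarrow>\<^sub>E Field r''"
    by (auto simp: compose_def)
next
  fix D s assume D: "directed r D \<and> is_lub r D s"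
  then have "directed r' (f ` D)" "is_lub r' (f ` D) (f s)"
    using scott_continuous_directed_image[OF assms(1) f] f by (auto simp: scott_continuous_def)
  then have "is_lub r'' (g ` f ` D) (g (f s))" using g by (simp add: scott_continuous_def)
  moreover have "compose (Field r) g f ` D = g ` f ` D" "compose (Field r) g f s = g (f s)"
    using D by (auto simp: compose_def directed_def is_lub_def image_iff)
  ultimately show "is_lub r'' (compose (Field r) g f ` D) (compose (Field r) g f s)" by simp
qed

lemma scott_continuous_ident: "scott_continuous r r (restrict (\<lambda>x. x) (Field r))"
  unfolding scott_continuous_def
proof (intro conjI allI impI)
  fix D s assume D: "directed r D \<and> is_lub r D s"
  then have "restrict (\<lambda>x. x) (Field r) ` D = D" "s \<in> Field r"
    by (auto simp: directed_def is_lub_def image_iff)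
  then show "is_lub r (restrict (\<lambda>x. x) (Field r) ` D) (restrict (\<lambda>x. x) (Field r) s)" using D by simp
qed auto

text \<open>Extensionality turns the unit laws into equalities of HOL functions: off the source both
  sides are \<open>undefined\<close>.\<close>

lemma is_category_CD: "is_category (CD \<kappa>)"
proof -
  have dcpo_Partial_order: "Partial_order r" if "continuous_domain r" for r :: "'u rel"
    using that by (simp add: continuous_domain_def dcpo_def)
  have ext: "f \<in> Field r \<rightarrow>\<^sub>E Field r'" if "scott_continuous r r' f" for r r' and f :: "'u \<Rightarrow> 'u"
    using that by (simp add: scott_continuous_def)
  show ?thesis
    unfolding is_category_def CD_def category.simps mem_Collect_eq
  proof (intro conjI ballI; (elim CollectE conjE)?)
    fix r r' and f :: "'u \<Rightarrow> 'u" assume "scott_continuous r r' f"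
    then have "f \<in> Field r \<rightarrow>\<^sub>E Field r'" by (rule ext)
    then show "compose (Field r) f (restrict (\<lambda>x. x) (Field r)) = f"
      and "compose (Field r) (restrict (\<lambda>x. x) (Field r')) f = f"
      by (auto simp: compose_def fun_eq_iff PiE_iff extensional_def)
  next
    fix q r s t and f g h :: "'u \<Rightarrow> 'u"
    assume "scott_continuous q r f" "scott_continuous r s g" "scott_continuous s t h"
    then have "f \<in> Field q \<rightarrow> Field r" using ext by auto
    then show "compose (Field q) h (compose (Field q) g f) = compose (Field q) (compose (Field r) h g) f"
      by (auto simp: compose_def fun_eq_iff)
  qed (auto intro: scott_continuous_compose scott_continuous_ident dcpo_Partial_order)
qed

section \<open>The way-below relation, interpolation and order isomorphisms\<close>

lemma way_below_imp_le:
  assumes "Partial_order r" "way_below r x y"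
  shows "(x, y) \<in> r"
proof -
  have "y \<in> Field r" using assms by (simp add: way_below_def)
  then have "directed r {y}" "is_lub r {y} y" "(y, y) \<in> r"
    using assms(1) by (auto simp: directed_def is_lub_def order_on_defs refl_on_def)
  then show ?thesis using assms(2) unfolding way_below_def by blast
qed

lemma way_below_le_trans:
  assumes r: "Partial_order r" and "way_below r x y" "(y, z) \<in> r"
  shows "way_below r x z"
proof -
  have "trans r" using r by (simp add: order_on_defs)
  then show ?thesis using assms(2,3) unfolding way_below_def by (meson FieldI2 transD)
qed

lemma le_way_below_trans:
  assumes r: "Partial_order r" and "(x, y) \<in> r" "way_below r y z"
  shows "way_below r x z"
proof -
  have "trans r" using r by (simp add: order_on_defs)
  then show ?thesis using assms(2,3) unfolding way_below_def by (meson FieldI1 transD)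
qed

lemma way_below_trans:
  "Partial_order r \<Longrightarrow> way_below r x y \<Longrightarrow> way_below r y z \<Longrightarrow> way_below r x z"
  by (rule way_below_le_trans[OF _ _ way_below_imp_le])

lemma directed_finite_upper_bound:
  assumes r: "Partial_order r" and D: "directed r D" and M: "finite M" "M \<subseteq> D"
  shows "\<exists>d\<in>D. \<forall>x\<in>M. (x, d) \<in> r"
  using M
proof (induction M rule: finite_induct)
  case empty
  then show ?case using D by (auto simp: directed_def)
next
  case (insert x M)
  then obtain d where d: "d \<in> D" "\<forall>y\<in>M. (y, d) \<in> r" by auto
  with D insert obtain e where e: "e \<in> D" "(x, e) \<in> r" "(d, e) \<in> r"
    unfolding directed_def by blast
  have "trans r" using r by (simp add: order_on_defs)
  then have "\<forall>y\<in>insert x M. (y, e) \<in> r" using d e by (auto dest: transD)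
  with e show ?case by blast
qed

text \<open>Later this provides idempotence of the kernel operator and consistency of the selection
  in the context of a basis.\<close>

lemma way_below_interpolation:
  assumes r: "Partial_order r" and B: "domain_basis r B" and bx: "way_below r b x"
  shows "\<exists>d\<in>B. way_below r b d \<and> way_below r d x"
proof -
  \<comment> \<open>This set is directed with least upper bound \<open>x\<close>, so \<open>b\<close> lies below one of its elements.\<close>
  define D where "D = {a\<in>B. \<exists>d\<in>B. way_below r a d \<and> way_below r d x}"
  have x: "x \<in> Field r" using bx by (simp add: way_below_def)
  have Bd: "directed r {b\<in>B. way_below r b y}" and Bl: "is_lub r {b\<in>B. way_below r b y} y"
    if "y \<in> Field r" for y using B that by (auto simp: domain_basis_def)
  have BF: "B \<subseteq> Field r" using B by (simp add: domain_basis_def)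
  have tr: "trans r" using r by (simp add: order_on_defs)
  have "directed r D"
    unfolding directed_def
  proof (intro conjI ballI)
    obtain d where d: "d \<in> B" "way_below r d x" using Bd[OF x] by (auto simp: directed_def)
    obtain a where "a \<in> B" "way_below r a d" using Bd[of d] d BF by (auto simp: directed_def)
    then show "D \<noteq> {}" using d by (auto simp: D_def)
  next
    fix a1 a2 assume "a1 \<in> D" "a2 \<in> D"
    then obtain d1 d2 where d: "a1 \<in> B" "a2 \<in> B" "d1 \<in> B" "d2 \<in> B" "way_below r a1 d1" "way_below r d1 x"
      "way_below r a2 d2" "way_below r d2 x" by (auto simp: D_def)
    obtain d where d': "d \<in> B" "way_below r d x" "(d1, d) \<in> r" "(d2, d) \<in> r"
      using Bd[OF x] d(3,4,6,8) unfolding directed_def by (smt (verit) mem_Collect_eq)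
    have "way_below r a1 d" "way_below r a2 d"
      using way_below_le_trans[OF r d(5) d'(3)] way_below_le_trans[OF r d(7) d'(4)] .
    moreover have "directed r {b\<in>B. way_below r b d}" using Bd d'(1) BF by blast
    ultimately obtain a where "a \<in> B" "way_below r a d" "(a1, a) \<in> r" "(a2, a) \<in> r"
      using d(1,2) unfolding directed_def by (smt (verit) mem_Collect_eq)
    then show "\<exists>z\<in>D. (a1, z) \<in> r \<and> (a2, z) \<in> r" using d' by (auto simp: D_def)
  qed (use BF in \<open>auto simp: D_def\<close>)
  moreover have "is_lub r D x"
    unfolding is_lub_def
  proof (intro conjI ballI impI)
    fix a assume "a \<in> D"
    then show "(a, x) \<in> r" using way_below_imp_le[OF r] tr unfolding D_def by (blast dest: transD)
  next
    \<comment> \<open>An upper bound passes through two suprema: \<open>u\<close> bounds the basis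
      elements way below \<open>d\<close>, hence \<open>d\<close>, for every basis element
      \<open>d\<close> way below \<open>x\<close>, hence \<open>x\<close>.\<close>
    fix u assume u: "u \<in> Field r" "\<forall>a\<in>D. (a, u) \<in> r"
    have "(d, u) \<in> r" if d: "d \<in> B" "way_below r d x" for d
      using Bl[of d] BF d u unfolding is_lub_def D_def by blast
    then show "(x, u) \<in> r" using Bl[OF x] u unfolding is_lub_def by blast
  qed (use x in auto)
  moreover have "(x, x) \<in> r" using r x by (simp add: order_on_defs refl_on_def)
  ultimately obtain a where "a \<in> D" "(b, a) \<in> r"
    using bx unfolding way_below_def by blast
  then show ?thesis using le_way_below_trans[OF r] unfolding D_def by blast
qed

text \<open>An order isomorphism preserves all least upper bounds, so it and its inverse are
  Scott-continuous. Injectivity follows from reflection of the order and antisymmetry.\<close>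

lemma isomorphism_CD_of_order_iso:
  fixes r r' :: "'u rel"
  assumes r: "Partial_order r" and r': "Partial_order r'"
    and f: "f ` Field r = Field r'"
    and le: "\<And>x y. x \<in> Field r \<Longrightarrow> y \<in> Field r \<Longrightarrow> (f x, f y) \<in> r' \<longleftrightarrow> (x, y) \<in> r"
  shows "isomorphism (CD \<kappa>) r r' (restrict f (Field r))"
proof -
  have inj: "inj_on f (Field r)"
    using r by (auto simp: inj_on_def order_on_defs refl_on_def antisym_def le[symmetric])
  define g where "g = inv_into (Field r) f"
  have gf: "g (f x) = x" if "x \<in> Field r" for x using inj that by (simp add: g_def)
  have fg: "f (g y) = y" "g y \<in> Field r" if "y \<in> Field r'" for y
    using that f by (auto simp: g_def f_inv_into_f inv_into_into)
  \<comment> \<open>Stated for arbitrary \<open>q\<close>, \<open>q'\<close> and \<open>h\<close>,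
    to be applied to \<open>f\<close> and to its inverse.\<close>
  have sc: "scott_continuous q q' (restrict h (Field q))"
    if "h ` Field q = Field q'" "\<And>x y. x \<in> Field q \<Longrightarrow> y \<in> Field q \<Longrightarrow> (h x, h y) \<in> q' \<longleftrightarrow> (x, y) \<in> q"
    for q q' and h :: "'u \<Rightarrow> 'u"
    unfolding scott_continuous_def
  proof (intro conjI allI impI)
    fix D s assume D: "directed q D \<and> is_lub q D s"
    then have DF: "D \<subseteq> Field q" "s \<in> Field q" by (auto simp: directed_def is_lub_def)
    then have "restrict h (Field q) ` D = h ` D" by (auto simp: image_iff)
    moreover have "is_lub q' (h ` D) (h s)"
      using D DF that unfolding is_lub_def by (auto simp flip: that(1) simp: subset_iff)
    ultimately show "is_lub q' (restrict h (Field q) ` D) (restrict h (Field q) s)" using DF by simp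
  qed (use that in auto)
  have "scott_continuous r r' (restrict f (Field r))" by (rule sc) (use f le in auto)
  moreover have "scott_continuous r' r (restrict g (Field r'))"
  proof (rule sc)
    show "g ` Field r' = Field r" using gf fg f by force
    fix x y assume "x \<in> Field r'" "y \<in> Field r'"
    then show "(g x, g y) \<in> r \<longleftrightarrow> (x, y) \<in> r'" using le[of "g x" "g y"] fg by simp
  qed
  ultimately show ?thesis
    unfolding isomorphism_def CD_def
    by (intro conjI bexI[of _ "restrict g (Field r')"])
      (use f fg gf in \<open>auto simp: compose_def fun_eq_iff\<close>)
qed

section \<open>The points of a context\<close>

text \<open>The points of a context are the rounded ideals for the relation \<open>F \<subseteq> \<lceil>G\<rceil>\<close> on the selected
  sets, represented by their unions.\<close>

definition pts :: "('o, 'a) fcontext \<Rightarrow> 'a set set" where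
  "pts P = {X. X \<subseteq> Attrs P \<and> (\<forall>F\<in>Sel P. F \<subseteq> X \<longrightarrow> br P F \<subseteq> X) \<and>
    (\<forall>M. finite M \<and> M \<subseteq> X \<longrightarrow> (\<exists>F\<in>Sel P. F \<subseteq> X \<and> M \<subseteq> br P F))}"

definition directed_family :: "'a set set \<Rightarrow> bool" where
  "directed_family \<D> \<longleftrightarrow> \<D> \<noteq> {} \<and> (\<forall>X\<in>\<D>. \<forall>Y\<in>\<D>. \<exists>Z\<in>\<D>. X \<subseteq> Z \<and> Y \<subseteq> Z)"

lemma directed_family_finite_subset:
  assumes D: "directed_family \<D>" and M: "finite M" "M \<subseteq> \<Union>\<D>"
  shows "\<exists>X\<in>\<D>. M \<subseteq> X"
  using M
proof (induction M rule: finite_induct)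
  case empty
  then show ?case using D by (auto simp: directed_family_def)
next
  case (insert x M)
  then obtain X Y where "X \<in> \<D>" "M \<subseteq> X" "Y \<in> \<D>" "x \<in> Y" by auto
  moreover from this obtain Z where "Z \<in> \<D>" "X \<subseteq> Z" "Y \<subseteq> Z"
    using D by (meson directed_family_def)
  ultimately show ?case by blast
qed

lemma pts_finite_upper_bound:
  assumes "X \<in> pts P" "finite M" "M \<subseteq> X"
  shows "\<exists>F\<in>Sel P. F \<subseteq> X \<and> M \<subseteq> br P F"
  using assms by (simp add: pts_def)

lemma pts_br_subset:
  assumes "X \<in> pts P" "F \<in> Sel P" "F \<subseteq> X"
  shows "br P F \<subseteq> X"
  using assms by (simp add: pts_def)

text \<open>Both conditions on a point speak of one finite subset at a time, and such a subset of a
  directed union already lies in one member.\<close>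

lemma Union_mem_pts:
  assumes D: "directed_family \<D>" "\<D> \<subseteq> pts P" and fin: "\<And>F. F \<in> Sel P \<Longrightarrow> finite F"
  shows "\<Union>\<D> \<in> pts P"
  unfolding pts_def
proof (intro CollectI conjI ballI allI impI)
  show "\<Union>\<D> \<subseteq> Attrs P" using D by (auto simp: pts_def)
next
  fix F assume F: "F \<in> Sel P" "F \<subseteq> \<Union>\<D>"
  then obtain X where "X \<in> \<D>" "F \<subseteq> X" using directed_family_finite_subset[OF D(1) fin] by blast
  then show "br P F \<subseteq> \<Union>\<D>" using F D(2) pts_br_subset by blast
next
  fix M assume M: "finite M \<and> M \<subseteq> \<Union>\<D>"
  then obtain X where X: "X \<in> \<D>" "M \<subseteq> X" using directed_family_finite_subset[OF D(1)] by blast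
  then obtain F where "F \<in> Sel P" "F \<subseteq> X" "M \<subseteq> br P F"
    using pts_finite_upper_bound[of X P M] D(2) M by blast
  then show "\<exists>F\<in>Sel P. F \<subseteq> \<Union>\<D> \<and> M \<subseteq> br P F" using X by blast
qed

context
  fixes P :: "('o, 'a) fcontext"
  assumes P: "attribute_continuous P"
begin

lemma Sel_finite: "F \<in> Sel P \<Longrightarrow> finite F"
  and Sel_Attrs: "F \<in> Sel P \<Longrightarrow> F \<subseteq> Attrs P"
  and Sel_nonempty: "Sel P \<noteq> {}"
  and Sel_interpolate: "F \<in> Sel P \<Longrightarrow> finite M \<Longrightarrow> M \<subseteq> br P F \<Longrightarrow>
    \<exists>G\<in>Sel P. M \<subseteq> br P G \<and> G \<subseteq> br P F"
  using P by (auto simp: attribute_continuous_def consistent_selection_def)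

lemma kernel_operator: "kernel_attribute_operator P"
  using P by (simp add: attribute_continuous_def)

text \<open>The kernel operator is contracting, so \<open>G\<close> lies in the closure of
  \<open>F\<close>; and the bracket of that closure is the bracket of \<open>F\<close>, because
  closure is idempotent.\<close>

lemma br_closed:
  assumes F: "F \<subseteq> Attrs P" and G: "G \<subseteq> br P F"
  shows "br P G \<subseteq> br P F"
proof -
  have c: "closure_of P F \<subseteq> Attrs P" "br P F \<subseteq> closure_of P F"
    using kernel_operator F by (auto simp: kernel_attribute_operator_def br_def attrs_of_def[of P])
  have "br P G \<subseteq> br P (closure_of P F)"
    by (rule br_mono[OF kernel_operator]) (use G c in blast)+
  moreover have "closure_of P (closure_of P F) = closure_of P F"
    using F unfolding attrs_of_def objs_of_def by blast
  ultimately show ?thesis by (simp add: br_def)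
qed

text \<open>Consistency of the selection says precisely that brackets of selected sets are
  rounded.\<close>

lemma br_mem_pts:
  assumes "F \<in> Sel P"
  shows "br P F \<in> pts P"
  unfolding pts_def
proof (intro CollectI conjI ballI allI impI)
  show "br P F \<subseteq> Attrs P" by (rule br_subset_Attrs[OF kernel_operator Sel_Attrs[OF assms]])
  show "br P G \<subseteq> br P F" if "G \<subseteq> br P F" for G by (rule br_closed[OF Sel_Attrs[OF assms] that])
  fix M assume "finite M \<and> M \<subseteq> br P F"
  then show "\<exists>G\<in>Sel P. G \<subseteq> br P F \<and> M \<subseteq> br P G" using Sel_interpolate[OF assms, of M] by auto
qed

text \<open>For selected \<open>F\<close> and \<open>G\<close> inside \<open>X\<close> the union is
  a finite subset of \<open>X\<close>, so it lies in the bracket of a selected \<open>H\<close>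
  inside \<open>X\<close>, and \<open>br_closed\<close> makes that bracket an upper bound.\<close>

lemma directed_family_br:
  assumes X: "X \<in> pts P"
  shows "directed_family {br P F |F. F \<in> Sel P \<and> F \<subseteq> X}"
proof -
  have "\<exists>H\<in>Sel P. H \<subseteq> X \<and> br P F \<subseteq> br P H \<and> br P G \<subseteq> br P H"
    if "F \<in> Sel P" "F \<subseteq> X" "G \<in> Sel P" "G \<subseteq> X" for F G
  proof -
    have "finite (F \<union> G)" "F \<union> G \<subseteq> X" using that Sel_finite by auto
    then obtain H where "H \<in> Sel P" "H \<subseteq> X" "F \<union> G \<subseteq> br P H"
      using pts_finite_upper_bound[OF X] by blast
    then show ?thesis using br_closed Sel_Attrs by (meson le_sup_iff)
  qed
  \<comment> \<open>The case of an empty \<open>M\<close> in the definition of \<open>pts\<close>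
    gives a selected set inside \<open>X\<close>, so the family is nonempty.\<close>
  moreover obtain F where "F \<in> Sel P" "F \<subseteq> X" using pts_finite_upper_bound[OF X, of "{}"] by auto
  ultimately show ?thesis unfolding directed_family_def
    by (intro conjI ballI) (blast, simp, metis)
qed

text \<open>With directedness this makes each point a directed union of brackets, so a continuous
  map is determined by its values at brackets.\<close>

lemma Union_br_eq:
  assumes X: "X \<in> pts P"
  shows "\<Union>{br P F |F. F \<in> Sel P \<and> F \<subseteq> X} = X"
proof
  show "X \<subseteq> \<Union>{br P F |F. F \<in> Sel P \<and> F \<subseteq> X}"
  proof
    fix x assume "x \<in> X"
    then obtain F where "F \<in> Sel P" "F \<subseteq> X" "{x} \<subseteq> br P F"
      using pts_finite_upper_bound[OF X, of "{x}"] by auto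
    then show "x \<in> \<Union>{br P F |F. F \<in> Sel P \<and> F \<subseteq> X}" by blast
  qed
qed (use pts_br_subset[OF X] in blast)

end

section \<open>F-morphisms as continuous maps between points\<close>

text \<open>Scott continuity before points are encoded: directed suprema of points are unions.
  Values outside \<open>pts P\<close> are left free.\<close>

definition continuous_on_pts :: "('o, 'a) fcontext \<Rightarrow> ('p, 'b) fcontext \<Rightarrow> ('a set \<Rightarrow> 'b set) \<Rightarrow> bool" where
  "continuous_on_pts P Q \<phi> \<longleftrightarrow> \<phi> \<in> pts P \<rightarrow> pts Q \<and>
    (\<forall>\<D>. directed_family \<D> \<and> \<D> \<subseteq> pts P \<longrightarrow> \<phi> (\<Union>\<D>) = \<Union>(\<phi> ` \<D>))"

definition rel_of :: "('o, 'a) fcontext \<Rightarrow> ('a set \<Rightarrow> 'b set) \<Rightarrow> ('a set \<times> 'b) set" where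
  "rel_of P \<phi> = {(F, x). F \<in> Sel P \<and> x \<in> \<phi> (br P F)}"

definition map_of_rel :: "('o, 'a) fcontext \<Rightarrow> ('a set \<times> 'b) set \<Rightarrow> 'a set \<Rightarrow> 'b set" where
  "map_of_rel P H X = {x. \<exists>F\<in>Sel P. F \<subseteq> X \<and> (F, x) \<in> H}"

lemma continuous_on_pts_mono:
  assumes "continuous_on_pts P Q \<phi>" "X \<in> pts P" "Y \<in> pts P" "X \<subseteq> Y"
  shows "\<phi> X \<subseteq> \<phi> Y"
proof -
  have "directed_family {X, Y}" "\<Union>{X, Y} = Y" using assms(4) by (auto simp: directed_family_def)
  then have "\<phi> Y = \<Union>(\<phi> ` {X, Y})"
    using assms unfolding continuous_on_pts_def by (metis empty_subsetI insert_subset)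
  then show ?thesis by auto
qed

lemma continuous_on_pts_br:
  assumes P: "attribute_continuous P" and \<phi>: "continuous_on_pts P Q \<phi>" and X: "X \<in> pts P"
  shows "\<phi> X = \<Union>{\<phi> (br P F) |F. F \<in> Sel P \<and> F \<subseteq> X}"
proof -
  have "{br P F |F. F \<in> Sel P \<and> F \<subseteq> X} \<subseteq> pts P" using br_mem_pts[OF P] by blast
  then have "\<phi> (\<Union>{br P F |F. F \<in> Sel P \<and> F \<subseteq> X}) = \<Union>(\<phi> ` {br P F |F. F \<in> Sel P \<and> F \<subseteq> X})"
    using \<phi> directed_family_br[OF P X] by (simp add: continuous_on_pts_def)
  moreover have "\<phi> ` {br P F |F. F \<in> Sel P \<and> F \<subseteq> X} = {\<phi> (br P F) |F. F \<in> Sel P \<and> F \<subseteq> X}"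
    by blast
  ultimately show ?thesis using Union_br_eq[OF P X] by simp
qed

context
  fixes P :: "('o, 'a) fcontext" and Q :: "('p, 'b) fcontext" and H
  assumes P: "attribute_continuous P" and Q: "attribute_continuous Q" and H: "F_morphism P Q H"
begin

lemma F_morphism_memD: "(F, x) \<in> H \<Longrightarrow> F \<in> Sel P" "(F, x) \<in> H \<Longrightarrow> x \<in> Attrs Q"
  using H by (auto simp: F_morphism_def)

lemma F_morphism_closed:
  assumes "F \<in> Sel P" "K \<in> Sel Q" "rel_all F H K" "x \<in> br Q K"
  shows "(F, x) \<in> H"
proof -
  have "x \<in> Attrs Q" using br_subset_Attrs[OF kernel_operator[OF Q] Sel_Attrs[OF Q assms(2)]] assms(4) by blast
  then show ?thesis using H assms by (simp add: F_morphism_def AR1_def)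
qed

lemma F_morphism_mono:
  assumes "F \<in> Sel P" "G \<subseteq> br P F" "(G, x) \<in> H"
  shows "(F, x) \<in> H"
  using H assms F_morphism_memD[OF assms(3)] unfolding F_morphism_def AR2_def by blast

lemma F_morphism_interpolate_right:
  assumes "F \<in> Sel P" "finite M" "rel_all F H M"
  shows "\<exists>K\<in>Sel Q. M \<subseteq> br Q K \<and> rel_all F H K"
proof -
  have "M \<subseteq> Attrs Q" using assms(3) F_morphism_memD(2) by (auto simp: rel_all_def)
  then show ?thesis using H assms by (simp add: F_morphism_def AR3_br_def)
qed

lemma F_morphism_interpolate:
  assumes "(F, x) \<in> H"
  shows "\<exists>K\<in>Sel P. \<exists>K'\<in>Sel Q. K \<subseteq> br P F \<and> x \<in> br Q K' \<and> rel_all K H K'"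
  using H assms F_morphism_memD[OF assms] by (simp add: F_morphism_def AR4_def)

text \<open>Elements of \<open>M\<close> may come from different selected sets. The union of these
  sets is finite, hence lies in the bracket of one selected \<open>G\<close> inside
  \<open>X\<close>, and (AR2) moves all pairs to \<open>G\<close>.\<close>

lemma map_of_rel_finite_subset:
  assumes X: "X \<in> pts P" and M: "finite M" "M \<subseteq> map_of_rel P H X"
  shows "\<exists>G\<in>Sel P. G \<subseteq> X \<and> rel_all G H M"
proof -
  have "\<forall>x\<in>M. \<exists>F. F \<in> Sel P \<and> F \<subseteq> X \<and> (F, x) \<in> H"
    using M(2) by (auto simp: map_of_rel_def)
  then obtain k where k: "\<forall>x\<in>M. k x \<in> Sel P \<and> k x \<subseteq> X \<and> (k x, x) \<in> H"
    by (rule bchoice[THEN exE])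
  have "finite (\<Union>(k ` M))" using k M(1) Sel_finite[OF P] by simp
  moreover have "\<Union>(k ` M) \<subseteq> X" using k by auto
  ultimately obtain G where G: "G \<in> Sel P" "G \<subseteq> X" "\<Union>(k ` M) \<subseteq> br P G"
    using pts_finite_upper_bound[OF X] by meson
  have "(G, x) \<in> H" if "x \<in> M" for x
  proof (rule F_morphism_mono[OF G(1)])
    show "k x \<subseteq> br P G" using G(3) that by auto
    show "(k x, x) \<in> H" using k that by simp
  qed
  with G show ?thesis by (auto simp: rel_all_def)
qed

text \<open>Once a finite set of values is attached to one selected set, (AR1) gives closure under
  brackets and the weak form of (AR3) gives roundedness.\<close>

lemma map_of_rel_mem_pts:
  assumes X: "X \<in> pts P"
  shows "map_of_rel P H X \<in> pts Q"
  unfolding pts_def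
proof (intro CollectI conjI ballI allI impI)
  show "map_of_rel P H X \<subseteq> Attrs Q" using F_morphism_memD by (auto simp: map_of_rel_def)
  fix F assume F: "F \<in> Sel Q" "F \<subseteq> map_of_rel P H X"
  then obtain G where G: "G \<in> Sel P" "G \<subseteq> X" "rel_all G H F"
    using map_of_rel_finite_subset[OF X Sel_finite[OF Q]] by blast
  then have "(G, x) \<in> H" if "x \<in> br Q F" for x
    using F_morphism_closed F(1) that by blast
  then show "br Q F \<subseteq> map_of_rel P H X" using G(1,2) by (auto simp: map_of_rel_def)
next
  fix M assume M: "finite M \<and> M \<subseteq> map_of_rel P H X"
  then obtain G where G: "G \<in> Sel P" "G \<subseteq> X" "rel_all G H M"
    using map_of_rel_finite_subset[OF X] by blast
  then obtain K where "K \<in> Sel Q" "M \<subseteq> br Q K" "rel_all G H K"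
    using F_morphism_interpolate_right[OF G(1) _ G(3)] M by blast
  then show "\<exists>K\<in>Sel Q. K \<subseteq> map_of_rel P H X \<and> M \<subseteq> br Q K"
    using G(1,2) by (auto simp: map_of_rel_def rel_all_def)
qed

lemma continuous_map_of_rel: "continuous_on_pts P Q (map_of_rel P H)"
proof -
  have "map_of_rel P H (\<Union>\<D>) = \<Union>(map_of_rel P H ` \<D>)" if D: "directed_family \<D>" for \<D>
  proof
    show "map_of_rel P H (\<Union>\<D>) \<subseteq> \<Union>(map_of_rel P H ` \<D>)"
    proof
      fix x assume "x \<in> map_of_rel P H (\<Union>\<D>)"
      then obtain F where F: "F \<in> Sel P" "F \<subseteq> \<Union>\<D>" "(F, x) \<in> H" by (auto simp: map_of_rel_def)
      then obtain X where "X \<in> \<D>" "F \<subseteq> X"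
        using directed_family_finite_subset[OF D Sel_finite[OF P]] by blast
      with F show "x \<in> \<Union>(map_of_rel P H ` \<D>)" by (auto simp: map_of_rel_def)
    qed
  qed (auto simp: map_of_rel_def)
  then show ?thesis using map_of_rel_mem_pts by (simp add: continuous_on_pts_def)
qed

text \<open>As \<open>F\<close> may lie outside \<open>br P F\<close>, the set \<open>F\<close> is
  no witness for the right-to-left direction. (AR4) replaces it by a selected \<open>K\<close>
  inside \<open>br P F\<close>, and (AR1) attaches \<open>x\<close> to \<open>K\<close>. The other
  direction is (AR2).\<close>

lemma mem_map_of_rel_br:
  assumes F: "F \<in> Sel P"
  shows "x \<in> map_of_rel P H (br P F) \<longleftrightarrow> (F, x) \<in> H"
proof
  assume "x \<in> map_of_rel P H (br P F)"
  then show "(F, x) \<in> H" using F_morphism_mono[OF F] by (auto simp: map_of_rel_def)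
next
  assume "(F, x) \<in> H"
  then obtain K K' where "K \<in> Sel P" "K' \<in> Sel Q" "K \<subseteq> br P F" "x \<in> br Q K'" "rel_all K H K'"
    using F_morphism_interpolate by blast
  then show "x \<in> map_of_rel P H (br P F)" using F_morphism_closed by (auto simp: map_of_rel_def)
qed

lemma rel_of_map_of_rel: "rel_of P (map_of_rel P H) = H"
  using F_morphism_memD by (auto simp: rel_of_def mem_map_of_rel_br)

end

lemma map_of_rel_of:
  assumes P: "attribute_continuous P" and \<phi>: "continuous_on_pts P Q \<phi>" and X: "X \<in> pts P"
  shows "map_of_rel P (rel_of P \<phi>) X = \<phi> X"
  by (subst continuous_on_pts_br[OF P \<phi> X]) (auto simp: map_of_rel_def rel_of_def)

text \<open>The values of \<open>\<phi>\<close> at brackets are points. Their closure under brackets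
  gives (AR1), their roundedness the weak (AR3); monotonicity of \<open>\<phi>\<close> gives (AR2),
  and continuity with roundedness gives (AR4).\<close>

lemma F_morphism_rel_of:
  assumes P: "attribute_continuous P" and Q: "attribute_continuous Q"
    and \<phi>: "continuous_on_pts P Q \<phi>"
  shows "F_morphism P Q (rel_of P \<phi>)"
proof -
  have pt: "\<phi> (br P F) \<in> pts Q" if "F \<in> Sel P" for F
    using \<phi> br_mem_pts[OF P that] by (auto simp: continuous_on_pts_def)
  have all: "rel_all F (rel_of P \<phi>) X \<longleftrightarrow> X \<subseteq> \<phi> (br P F)" if "F \<in> Sel P" for F X
    using that by (auto simp: rel_all_def rel_of_def)
  have Attrs: "x \<in> Attrs Q" if "F \<in> Sel P" "x \<in> \<phi> (br P F)" for F x
    using pt[OF that(1)] that(2) by (auto simp: pts_def)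
  have "rel_of P \<phi> \<subseteq> Sel P \<times> Attrs Q" using Attrs by (auto simp: rel_of_def)
  moreover have "AR1 P Q (rel_of P \<phi>)"
    unfolding AR1_def
  proof (intro ballI impI)
    fix F F' x assume F: "F \<in> Sel P" "F' \<in> Sel Q" "rel_all F (rel_of P \<phi>) F' \<and> x \<in> br Q F'"
    then have "br Q F' \<subseteq> \<phi> (br P F)" using pts_br_subset[OF pt[OF F(1)] F(2)] all[OF F(1)] by simp
    then show "(F, x) \<in> rel_of P \<phi>" using F by (auto simp: rel_of_def)
  qed
  moreover have "AR2 P Q (rel_of P \<phi>)"
    unfolding AR2_def
  proof (intro ballI impI)
    fix F G x assume F: "F \<in> Sel P" "G \<in> Sel P" "G \<subseteq> br P F \<and> (G, x) \<in> rel_of P \<phi>"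
    then have "br P G \<subseteq> br P F" using br_closed[OF P Sel_Attrs[OF P F(1)]] by simp
    then have "\<phi> (br P G) \<subseteq> \<phi> (br P F)"
      by (rule continuous_on_pts_mono[OF \<phi> br_mem_pts[OF P F(2)] br_mem_pts[OF P F(1)]])
    then show "(F, x) \<in> rel_of P \<phi>" using F by (auto simp: rel_of_def)
  qed
  moreover have "AR3_br P Q (rel_of P \<phi>)"
    unfolding AR3_br_def
  proof (intro ballI allI impI)
    fix F M assume F: "F \<in> Sel P" and M: "finite M \<and> M \<subseteq> Attrs Q \<and> rel_all F (rel_of P \<phi>) M"
    then show "\<exists>K\<in>Sel Q. M \<subseteq> br Q K \<and> rel_all F (rel_of P \<phi>) K"
      using pts_finite_upper_bound[OF pt[OF F], of M] all[OF F] by auto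
  qed
  moreover have "AR4 P Q (rel_of P \<phi>)"
    unfolding AR4_def
  proof (intro ballI impI)
    fix F x assume F: "F \<in> Sel P" and "(F, x) \<in> rel_of P \<phi>"
    then have "x \<in> \<phi> (br P F)" by (simp add: rel_of_def)
    \<comment> \<open>Continuity is used here: \<open>br P F\<close> is the directed union of the
      brackets of the selected \<open>K\<close> inside it, so \<open>x\<close> is already a value at
      one of them.\<close>
    then obtain K where K: "K \<in> Sel P" "K \<subseteq> br P F" "x \<in> \<phi> (br P K)"
      by (subst (asm) continuous_on_pts_br[OF P \<phi> br_mem_pts[OF P F]]) auto
    then obtain K' where "K' \<in> Sel Q" "K' \<subseteq> \<phi> (br P K)" "{x} \<subseteq> br Q K'"
      using pts_finite_upper_bound[OF pt[OF K(1)], of "{x}"] by auto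
    then show "\<exists>K\<in>Sel P. \<exists>K'\<in>Sel Q. K \<subseteq> br P F \<and> x \<in> br Q K' \<and> rel_all K (rel_of P \<phi>) K'"
      using K(1,2) all[OF K(1)] by blast
  qed
  ultimately show ?thesis by (simp add: F_morphism_def)
qed

text \<open>This form makes the morphism conditions for the identity a case of
  \<open>F_morphism_rel_of\<close>.\<close>

lemma F_ident_eq_rel_of:
  assumes P: "attribute_continuous P"
  shows "F_ident P = rel_of P (\<lambda>X. X)"
  using br_subset_Attrs[OF kernel_operator[OF P] Sel_Attrs[OF P]] by (auto simp: F_ident_def rel_of_def)

lemma continuous_on_pts_ident: "continuous_on_pts P P (\<lambda>X. X)"
  by (simp add: continuous_on_pts_def)

lemma F_morphism_F_ident: "attribute_continuous P \<Longrightarrow> F_morphism P P (F_ident P)"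
  by (simp add: F_ident_eq_rel_of F_morphism_rel_of continuous_on_pts_ident)

lemma directed_family_image:
  assumes \<phi>: "continuous_on_pts P Q \<phi>" and D: "\<D> \<subseteq> pts P" "directed_family \<D>"
  shows "directed_family (\<phi> ` \<D>)"
  unfolding directed_family_def
proof (intro conjI ballI)
  fix X Y assume "X \<in> \<phi> ` \<D>" "Y \<in> \<phi> ` \<D>"
  then obtain X' Y' where XY: "X' \<in> \<D>" "Y' \<in> \<D>" "X = \<phi> X'" "Y = \<phi> Y'" by blast
  then obtain Z where Z: "Z \<in> \<D>" "X' \<subseteq> Z" "Y' \<subseteq> Z" using D by (meson directed_family_def)
  then have "X \<subseteq> \<phi> Z" "Y \<subseteq> \<phi> Z"
    using XY D continuous_on_pts_mono[OF \<phi>, of X' Z] continuous_on_pts_mono[OF \<phi>, of Y' Z] by auto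
  then show "\<exists>Z\<in>\<phi> ` \<D>. X \<subseteq> Z \<and> Y \<subseteq> Z" using Z(1) by blast
qed (use D in \<open>simp add: directed_family_def\<close>)

lemma continuous_on_pts_comp:
  assumes \<phi>: "continuous_on_pts P Q \<phi>" and \<psi>: "continuous_on_pts Q R \<psi>"
  shows "continuous_on_pts P R (\<lambda>X. \<psi> (\<phi> X))"
  unfolding continuous_on_pts_def
proof (intro conjI allI impI)
  show "(\<lambda>X. \<psi> (\<phi> X)) \<in> pts P \<rightarrow> pts R"
    using \<phi> \<psi> by (auto simp: continuous_on_pts_def)
next
  fix \<D> assume D: "directed_family \<D> \<and> \<D> \<subseteq> pts P"
  then have "directed_family (\<phi> ` \<D>)" using directed_family_image[OF \<phi>] by blast
  moreover have "\<phi> ` \<D> \<subseteq> pts Q" using D \<phi> by (auto simp: continuous_on_pts_def)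
  ultimately have "\<psi> (\<Union>(\<phi> ` \<D>)) = \<Union>(\<psi> ` \<phi> ` \<D>)" using \<psi> by (simp add: continuous_on_pts_def)
  then show "\<psi> (\<phi> (\<Union>\<D>)) = (\<Union>X\<in>\<D>. \<psi> (\<phi> X))"
    using D \<phi> by (simp add: continuous_on_pts_def image_image)
qed

text \<open>The intermediate \<open>G\<close> in the composite satisfies
  \<open>rel_all F H G\<close>, which says that \<open>G\<close> is contained in the point
  \<open>map_of_rel P H (br P F)\<close>; this is the witness that \<open>map_of_rel Q H'\<close>
  asks for.\<close>

lemma F_comp_eq_rel_of:
  assumes P: "attribute_continuous P" and Q: "attribute_continuous Q"
    and H: "F_morphism P Q H" and H': "F_morphism Q R H'"
  shows "F_comp P Q R H H' = rel_of P (\<lambda>X. map_of_rel Q H' (map_of_rel P H X))"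
proof -
  have all: "G \<subseteq> map_of_rel P H (br P F) \<longleftrightarrow> rel_all F H G" if "F \<in> Sel P" for F G
    using mem_map_of_rel_br[OF P Q H that] by (auto simp: rel_all_def)
  have "H' \<subseteq> Sel Q \<times> Attrs R" using H' by (simp add: F_morphism_def)
  then show ?thesis unfolding F_comp_def rel_of_def map_of_rel_def[of Q] by (auto simp: all)
qed

section \<open>The domain of a context\<close>

text \<open>Objects of \<^const>\<open>CD\<close> are orders on a fixed type, so the points, which are sets, are encoded
  by an injection \<open>e\<close>.\<close>

definition pts_order :: "('a set \<Rightarrow> 'u) \<Rightarrow> ('o, 'a) fcontext \<Rightarrow> 'u rel" where
  "pts_order e P = {(e X, e Y) |X Y. X \<in> pts P \<and> Y \<in> pts P \<and> X \<subseteq> Y}"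

lemma Field_pts_order: "Field (pts_order e P) = e ` pts P"
  unfolding Field_def pts_order_def by auto

lemma Field_pts_order_nonempty: "attribute_continuous P \<Longrightarrow> Field (pts_order e P) \<noteq> {}"
  using Sel_nonempty br_mem_pts by (auto simp: Field_pts_order)

lemma pts_order_iff:
  assumes "inj_on e (pts P)" "X \<in> pts P" "Y \<in> pts P"
  shows "(e X, e Y) \<in> pts_order e P \<longleftrightarrow> X \<subseteq> Y"
  using assms unfolding pts_order_def by (auto dest: inj_onD)

lemma subset_Field_pts_orderE:
  assumes "D \<subseteq> Field (pts_order e P)"
  obtains \<D> where "\<D> \<subseteq> pts P" "D = e ` \<D>"
  using assms unfolding Field_pts_order subset_image_iff by blast

context
  fixes P :: "('o, 'a) fcontext" and e :: "'a set \<Rightarrow> 'u"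
  assumes P: "attribute_continuous P" and e: "inj_on e (pts P)"
begin

lemma Partial_order_pts_order: "Partial_order (pts_order e P)"
proof -
  have "refl_on (Field (pts_order e P)) (pts_order e P)"
    unfolding refl_on_def Field_pts_order by (auto simp: pts_order_iff[OF e])
  moreover have "trans (pts_order e P)"
  proof (rule transI)
    fix x y z assume "(x, y) \<in> pts_order e P" "(y, z) \<in> pts_order e P"
    then obtain X Y Y' Z where "x = e X" "y = e Y" "y = e Y'" "z = e Z" "X \<in> pts P" "Y \<in> pts P"
      "Y' \<in> pts P" "Z \<in> pts P" "X \<subseteq> Y" "Y' \<subseteq> Z" unfolding pts_order_def by blast
    moreover from this have "Y = Y'" using e by (auto dest: inj_onD)
    ultimately show "(x, z) \<in> pts_order e P" by (simp add: pts_order_iff[OF e])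
  qed
  moreover have "antisym (pts_order e P)"
  proof (rule antisymI)
    fix x y assume xy: "(x, y) \<in> pts_order e P" "(y, x) \<in> pts_order e P"
    then obtain X Y where "x = e X" "y = e Y" "X \<in> pts P" "Y \<in> pts P" unfolding pts_order_def by blast
    with xy show "x = y" by (simp add: pts_order_iff[OF e])
  qed
  moreover have "pts_order e P \<subseteq> Field (pts_order e P) \<times> Field (pts_order e P)"
    by (auto simp: Field_def)
  ultimately show ?thesis by (simp add: order_on_defs)
qed

lemma directed_pts_order_iff:
  assumes "\<D> \<subseteq> pts P"
  shows "directed (pts_order e P) (e ` \<D>) \<longleftrightarrow> directed_family \<D>"
proof -
  have "(e X, e Z) \<in> pts_order e P \<longleftrightarrow> X \<subseteq> Z" if "X \<in> \<D>" "Z \<in> \<D>" for X Z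
    using that assms by (auto simp: pts_order_iff[OF e] subset_iff)
  then show ?thesis
    using assms by (simp add: directed_def directed_family_def Field_pts_order image_mono)
qed

lemma is_lub_Union:
  assumes "\<D> \<subseteq> pts P" "directed_family \<D>"
  shows "is_lub (pts_order e P) (e ` \<D>) (e (\<Union>\<D>))"
proof -
  have U: "\<Union>\<D> \<in> pts P" using Union_mem_pts[OF assms(2,1)] Sel_finite[OF P] by blast
  show ?thesis
    unfolding is_lub_def Field_pts_order
  proof (intro conjI ballI impI)
    fix x assume "x \<in> e ` \<D>"
    then obtain X where "X \<in> \<D>" "x = e X" by blast
    then show "(x, e (\<Union>\<D>)) \<in> pts_order e P" using assms(1) U pts_order_iff[OF e, of X "\<Union>\<D>"] by auto
  next
    fix u assume "u \<in> e ` pts P" and ub: "\<forall>x\<in>e ` \<D>. (x, u) \<in> pts_order e P"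
    then obtain Y where Y: "Y \<in> pts P" "u = e Y" by blast
    have "X \<subseteq> Y" if "X \<in> \<D>" for X
      using ub Y assms(1) that pts_order_iff[OF e, of X Y] by auto
    then show "(e (\<Union>\<D>), u) \<in> pts_order e P" using Y U by (auto simp: pts_order_iff[OF e])
  qed (use U in blast)
qed

lemma is_lub_pts_order_eq:
  assumes "\<D> \<subseteq> pts P" "directed_family \<D>" "is_lub (pts_order e P) (e ` \<D>) s"
  shows "s = e (\<Union>\<D>)"
proof (rule is_lub_unique[OF _ assms(3) is_lub_Union[OF assms(1,2)]])
  show "antisym (pts_order e P)" using Partial_order_pts_order by (simp add: order_on_defs)
qed

lemma dcpo_pts_order: "dcpo (pts_order e P)"
  unfolding dcpo_def
proof (intro conjI allI impI Partial_order_pts_order)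
  fix D assume D: "directed (pts_order e P) D"
  then have "D \<subseteq> Field (pts_order e P)" by (simp add: directed_def)
  then obtain \<D> where "\<D> \<subseteq> pts P" "D = e ` \<D>" by (rule subset_Field_pts_orderE)
  then show "\<exists>s. is_lub (pts_order e P) D s" using D is_lub_Union directed_pts_order_iff by blast
qed

text \<open>If \<open>Y\<close> lies below a directed union, the finite set \<open>F\<close> lies in
  one member, and that member, being a point, contains \<open>br P F\<close>.\<close>

lemma way_below_br:
  assumes F: "F \<in> Sel P" "F \<subseteq> Y" and Y: "Y \<in> pts P"
  shows "way_below (pts_order e P) (e (br P F)) (e Y)"
  unfolding way_below_def
proof (intro conjI allI impI)
  show "e (br P F) \<in> Field (pts_order e P)" "e Y \<in> Field (pts_order e P)"
    using br_mem_pts[OF P F(1)] Y by (auto simp: Field_pts_order)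
next
  fix D s
  assume D: "directed (pts_order e P) D \<and> is_lub (pts_order e P) D s \<and> (e Y, s) \<in> pts_order e P"
  then have "D \<subseteq> Field (pts_order e P)" by (simp add: directed_def)
  then obtain \<D> where \<D>: "\<D> \<subseteq> pts P" "D = e ` \<D>" by (rule subset_Field_pts_orderE)
  with D have dir: "directed_family \<D>" by (simp add: directed_pts_order_iff)
  have U: "\<Union>\<D> \<in> pts P" using Union_mem_pts[OF dir \<D>(1)] Sel_finite[OF P] by blast
  have "s = e (\<Union>\<D>)" using is_lub_pts_order_eq[OF \<D>(1) dir] D \<D>(2) by simp
  then have "F \<subseteq> \<Union>\<D>" using D F(2) U Y by (auto simp: pts_order_iff[OF e])
  then obtain X where X: "X \<in> \<D>" "F \<subseteq> X"
    using directed_family_finite_subset[OF dir Sel_finite[OF P F(1)]] by blast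
  then have "X \<in> pts P" using \<D>(1) by blast
  then have "(e (br P F), e X) \<in> pts_order e P"
    using pts_br_subset[OF _ F(1) X(2)] by (simp add: pts_order_iff[OF e] br_mem_pts[OF P F(1)])
  then show "\<exists>d\<in>D. (e (br P F), d) \<in> pts_order e P" using X \<D> by blast
qed

text \<open>The way-below property is tested on the directed family of brackets with union
  \<open>Y\<close>.\<close>

lemma way_below_pts_orderD:
  assumes X: "X \<in> pts P" and Y: "Y \<in> pts P" and "way_below (pts_order e P) (e X) (e Y)"
  shows "\<exists>F\<in>Sel P. F \<subseteq> Y \<and> X \<subseteq> br P F"
proof -
  define \<D> where "\<D> = {br P F |F. F \<in> Sel P \<and> F \<subseteq> Y}"
  have \<D>: "\<D> \<subseteq> pts P" "directed_family \<D>" "\<Union>\<D> = Y"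
    unfolding \<D>_def Union_br_eq[OF P Y] using br_mem_pts[OF P] by (auto intro: directed_family_br[OF P Y])
  then have "directed (pts_order e P) (e ` \<D>)" "is_lub (pts_order e P) (e ` \<D>) (e Y)"
    "(e Y, e Y) \<in> pts_order e P"
    using is_lub_Union[OF \<D>(1,2)] Y by (simp_all add: directed_pts_order_iff pts_order_iff[OF e])
  then obtain d where "d \<in> e ` \<D>" "(e X, d) \<in> pts_order e P"
    using assms(3) unfolding way_below_def by blast
  then obtain F where F: "F \<in> Sel P" "F \<subseteq> Y" "(e X, e (br P F)) \<in> pts_order e P" by (auto simp: \<D>_def)
  then have "X \<subseteq> br P F" using pts_order_iff[OF e X br_mem_pts[OF P F(1)]] by simp
  with F show ?thesis by blast
qed

lemma domain_basis_br: "domain_basis (pts_order e P) (e ` br P ` Sel P)"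
  unfolding domain_basis_def
proof (intro conjI ballI)
  show "e ` br P ` Sel P \<subseteq> Field (pts_order e P)"
    using br_mem_pts[OF P] by (auto simp: Field_pts_order)
next
  fix y assume "y \<in> Field (pts_order e P)"
  then obtain Y where Y: "Y \<in> pts P" "y = e Y" by (auto simp: Field_pts_order)
  \<comment> \<open>A bracket can be way below \<open>Y\<close> although its \<open>F\<close> is not
    contained in \<open>Y\<close>. Brackets of selected subsets of \<open>Y\<close> are cofinal in
    this family, and directedness and union are read off from them.\<close>
  define \<D> where "\<D> = {br P F |F. F \<in> Sel P \<and> way_below (pts_order e P) (e (br P F)) y}"
  have pt: "\<D> \<subseteq> pts P" using br_mem_pts[OF P] by (auto simp: \<D>_def)
  have up: "\<exists>F\<in>Sel P. F \<subseteq> Y \<and> X \<subseteq> br P F" if "X \<in> \<D>" for X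
  proof (rule way_below_pts_orderD[OF _ Y(1)])
    show "X \<in> pts P" using that pt by blast
    show "way_below (pts_order e P) (e X) (e Y)" using that by (auto simp: \<D>_def Y(2))
  qed
  have mem: "br P F \<in> \<D>" if "F \<in> Sel P" "F \<subseteq> Y" for F
    using way_below_br[OF that Y(1)] that by (auto simp: \<D>_def Y(2))
  have dY: "directed_family {br P F |F. F \<in> Sel P \<and> F \<subseteq> Y}" by (rule directed_family_br[OF P Y(1)])
  have "directed_family \<D>"
    unfolding directed_family_def
  proof (intro conjI ballI)
    have "{br P F |F. F \<in> Sel P \<and> F \<subseteq> Y} \<noteq> {}" using dY unfolding directed_family_def by (rule conjunct1)
    then show "\<D> \<noteq> {}" using mem by blast
  next
    fix X1 X2 assume "X1 \<in> \<D>" "X2 \<in> \<D>"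
    then obtain F1 F2 where F: "F1 \<in> Sel P" "F1 \<subseteq> Y" "X1 \<subseteq> br P F1" "F2 \<in> Sel P" "F2 \<subseteq> Y" "X2 \<subseteq> br P F2"
      using up by meson
    then have "br P F1 \<in> {br P F |F. F \<in> Sel P \<and> F \<subseteq> Y}" "br P F2 \<in> {br P F |F. F \<in> Sel P \<and> F \<subseteq> Y}"
      by auto
    then obtain Z where Z: "Z \<in> {br P F |F. F \<in> Sel P \<and> F \<subseteq> Y}" "br P F1 \<subseteq> Z" "br P F2 \<subseteq> Z"
      using dY unfolding directed_family_def by meson
    then have "Z \<in> \<D>" using mem by auto
    with Z F show "\<exists>Z\<in>\<D>. X1 \<subseteq> Z \<and> X2 \<subseteq> Z" by (meson order_trans)
  qed
  moreover have "\<Union>\<D> = Y"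
  proof
    show "\<Union>\<D> \<subseteq> Y"
    proof
      fix x assume "x \<in> \<Union>\<D>"
      then obtain F where "F \<in> Sel P" "F \<subseteq> Y" "x \<in> br P F" using up by blast
      then show "x \<in> Y" using pts_br_subset[OF Y(1)] by blast
    qed
    have "{br P F |F. F \<in> Sel P \<and> F \<subseteq> Y} \<subseteq> \<D>" using mem by auto
    from Union_mono[OF this] show "Y \<subseteq> \<Union>\<D>" unfolding Union_br_eq[OF P Y(1)] .
  qed
  moreover have "{b \<in> e ` br P ` Sel P. way_below (pts_order e P) b y} = e ` \<D>"
    by (auto simp: \<D>_def)
  ultimately show "directed (pts_order e P) {b \<in> e ` br P ` Sel P. way_below (pts_order e P) b y}"
    and "is_lub (pts_order e P) {b \<in> e ` br P ` Sel P. way_below (pts_order e P) b y} y"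
    using is_lub_Union[OF pt] by (simp_all add: directed_pts_order_iff[OF pt] Y(2))
qed

end

section \<open>Translation between Scott-continuous functions and maps of points\<close>

context
  fixes P :: "('o, 'a) fcontext" and e :: "'a set \<Rightarrow> 'u"
    and Q :: "('p, 'b) fcontext" and e' :: "'b set \<Rightarrow> 'v"
  assumes P: "attribute_continuous P" and e: "inj_on e (pts P)"
    and Q: "attribute_continuous Q" and e': "inj_on e' (pts Q)"
begin

lemma scott_continuous_encode:
  assumes \<phi>: "continuous_on_pts P Q \<phi>"
  shows "scott_continuous (pts_order e P) (pts_order e' Q)
    (restrict (\<lambda>u. e' (\<phi> (inv_into (pts P) e u))) (e ` pts P))" (is "scott_continuous _ _ ?f")
  unfolding scott_continuous_def Field_pts_order
proof (intro conjI allI impI)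
  have fe: "?f (e X) = e' (\<phi> X)" if "X \<in> pts P" for X using e that by simp
  show "?f \<in> e ` pts P \<rightarrow>\<^sub>E e' ` pts Q"
    using \<phi> e by (auto simp: continuous_on_pts_def)
  fix D s assume D: "directed (pts_order e P) D \<and> is_lub (pts_order e P) D s"
  then have "D \<subseteq> Field (pts_order e P)" by (simp add: directed_def)
  then obtain \<D> where \<D>: "\<D> \<subseteq> pts P" "D = e ` \<D>" by (rule subset_Field_pts_orderE)
  with D have dir: "directed_family \<D>" by (simp add: directed_pts_order_iff[OF P e])
  have s: "s = e (\<Union>\<D>)" using is_lub_pts_order_eq[OF P e \<D>(1) dir] D \<D>(2) by simp
  have U: "\<Union>\<D> \<in> pts P" using Union_mem_pts[OF dir \<D>(1)] Sel_finite[OF P] by blast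
  have "\<phi> ` \<D> \<subseteq> pts Q" using \<phi> \<D>(1) by (auto simp: continuous_on_pts_def)
  moreover have "directed_family (\<phi> ` \<D>)" by (rule directed_family_image[OF \<phi> \<D>(1) dir])
  ultimately have "is_lub (pts_order e' Q) (e' ` \<phi> ` \<D>) (e' (\<Union>(\<phi> ` \<D>)))"
    by (rule is_lub_Union[OF Q e'])
  moreover have "\<phi> (\<Union>\<D>) = \<Union>(\<phi> ` \<D>)" using \<phi> \<D>(1) dir by (simp add: continuous_on_pts_def)
  moreover have "?f ` D = e' ` \<phi> ` \<D>"
    unfolding \<D>(2) image_image using fe \<D>(1) by (intro image_cong) auto
  ultimately show "is_lub (pts_order e' Q) (?f ` D) (?f s)" using fe[OF U] s by metis
qed

lemma continuous_on_pts_decode: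
  assumes f: "scott_continuous (pts_order e P) (pts_order e' Q) f"
  shows "continuous_on_pts P Q (\<lambda>X. inv_into (pts Q) e' (f (e X)))" (is "continuous_on_pts _ _ ?g")
  unfolding continuous_on_pts_def
proof (intro conjI allI impI)
  have fF: "f (e X) \<in> e' ` pts Q" if "X \<in> pts P" for X
    using f that by (auto simp: scott_continuous_def Field_pts_order)
  then show g: "?g \<in> pts P \<rightarrow> pts Q" by (auto simp: inv_into_into)
  fix \<D> assume D: "directed_family \<D> \<and> \<D> \<subseteq> pts P"
  have e'g: "e' (?g X) = f (e X)" if "X \<in> pts P" for X using fF[OF that] by (rule f_inv_into_f)
  have dir: "directed (pts_order e P) (e ` \<D>)" using D directed_pts_order_iff[OF P e] by blast
  \<comment> \<open>Monotonicity of the decoded map is not yet known, so directedness of the image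
    is obtained on the encoded side and carried back.\<close>
  have "directed (pts_order e' Q) (f ` e ` \<D>)"
    by (rule scott_continuous_directed_image[OF Partial_order_pts_order[OF P e] f dir])
  moreover have img: "f ` e ` \<D> = e' ` ?g ` \<D>"
    unfolding image_image using e'g D by (intro image_cong) auto
  moreover have gD: "?g ` \<D> \<subseteq> pts Q" using g D by blast
  ultimately have dir': "directed_family (?g ` \<D>)" using directed_pts_order_iff[OF Q e' gD] by simp
  have U: "\<Union>\<D> \<in> pts P" using Union_mem_pts[of \<D> P] D Sel_finite[OF P] by blast
  have "is_lub (pts_order e P) (e ` \<D>) (e (\<Union>\<D>))" using is_lub_Union[OF P e] D by blast
  then have "is_lub (pts_order e' Q) (f ` e ` \<D>) (f (e (\<Union>\<D>)))"
    using f dir by (simp add: scott_continuous_def)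
  then have "f (e (\<Union>\<D>)) = e' (\<Union>(?g ` \<D>))"
    unfolding img by (rule is_lub_pts_order_eq[OF Q e' gD dir'])
  moreover have "\<Union>(?g ` \<D>) \<in> pts Q" using Union_mem_pts[OF dir' gD] Sel_finite[OF Q] by blast
  ultimately show "?g (\<Union>\<D>) = \<Union>(?g ` \<D>)" using e' by simp
qed

end

section \<open>Counting finite subsets\<close>

text \<open>Bounds the number of selected sets, which index the basis of brackets. For infinite
  \<open>A\<close> there are at most \<open>|A|\<close> subsets of each finite size, and countably
  many sizes.\<close>

lemma Fpow_ordLess:
  assumes \<kappa>: "Cinfinite \<kappa>" and A: "|A| <o \<kappa>"
  shows "|{F. F \<subseteq> A \<and> finite F}| <o \<kappa>"
proof (cases "finite A")
  case True
  have "finite {F. F \<subseteq> A \<and> finite F}" using True by simp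
  then show ?thesis
    using \<kappa> card_order_on_well_order_on[of "Field \<kappa>" \<kappa>]
    by (intro finite_ordLess_infinite[OF card_of_Well_order]) (simp_all add: cinfinite_def Field_card_of)
next
  case False
  define S where "S n = {F. F \<subseteq> A \<and> finite F \<and> card F = n}" for n :: nat
  have "|S n| \<le>o |A|" for n
  proof (induction n)
    case 0
    have "S 0 = {{}}" by (auto simp: S_def)
    then show ?case using False card_of_singl_ordLeq[of A "{}"] by auto
  next
    case (Suc n)
    have "S (Suc n) \<subseteq> (\<lambda>(a, F). insert a F) ` (A \<times> S n)"
    proof
      fix F assume F: "F \<in> S (Suc n)"
      then have "F \<noteq> {}" by (auto simp: S_def)
      then obtain a where a: "a \<in> F" by blast
      have "F = (\<lambda>(a, F). insert a F) (a, F - {a})" using a by (simp add: insert_absorb)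
      moreover have "(a, F - {a}) \<in> A \<times> S n" using F a by (auto simp: S_def)
      ultimately show "F \<in> (\<lambda>(a, F). insert a F) ` (A \<times> S n)" by (rule image_eqI)
    qed
    then have "|S (Suc n)| \<le>o |A \<times> S n|" by (rule surj_imp_ordLeq)
    also have "|A \<times> S n| \<le>o |A|"
      by (rule card_of_Times_ordLeq_infinite_Field) (use False Suc in \<open>simp_all add: Field_card_of card_of_card_order_on card_of_mono1\<close>)
    finally show ?case .
  qed
  then have "|\<Union>n. S n| \<le>o |A|"
    by (intro card_of_UNION_ordLeq_infinite False ballI) (use False in \<open>simp_all add: infinite_iff_card_of_nat\<close>)
  moreover have "(\<Union>n. S n) = {F. F \<subseteq> A \<and> finite F}" by (auto simp: S_def)
  ultimately show ?thesis using ordLeq_ordLess_trans[OF _ A] by simp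
qed

section \<open>The context of a basis\<close>

text \<open>With this incidence relation the closed sets of attributes are the lower sets of the basis.\<close>

definition basis_context :: "'u rel \<Rightarrow> 'u set \<Rightarrow> ('u, 'u) fcontext" where
  "basis_context r B =
    \<lparr>Objs = B, Attrs = B, Sat = {(m, n). m \<in> B \<and> n \<in> B \<and> (m, n) \<notin> r},
     Ker = restrict (\<lambda>X. {b\<in>B. \<exists>c\<in>X. way_below r b c}) (Pow B),
     Sel = {F. finite F \<and> F \<subseteq> B \<and> (\<exists>m\<in>F. \<forall>x\<in>F. (x, m) \<in> r)}\<rparr>"

context
  fixes r :: "'u rel" and B :: "'u set"
  assumes dcpo: "dcpo r" and B: "domain_basis r B" and ne: "Field r \<noteq> {}"
begin

lemma dcpo_Partial_order: "Partial_order r"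
  using dcpo by (simp add: dcpo_def)

lemma basis_Field: "b \<in> B \<Longrightarrow> b \<in> Field r"
  using B by (auto simp: domain_basis_def)

lemma basis_refl: "b \<in> B \<Longrightarrow> (b, b) \<in> r"
  using dcpo_Partial_order basis_Field by (auto simp: order_on_defs refl_on_def)

lemma basis_directed: "x \<in> Field r \<Longrightarrow> directed r {b\<in>B. way_below r b x}"
  and basis_is_lub: "x \<in> Field r \<Longrightarrow> is_lub r {b\<in>B. way_below r b x} x"
  using B by (simp_all add: domain_basis_def)

text \<open>Interpolants are chosen for each \<open>b\<close> separately; basis elements way below
  \<open>x\<close> are directed, so one of them bounds all interpolants.\<close>

lemma way_below_interpolation_finite:
  assumes x: "x \<in> Field r" and M: "finite M" "\<And>b. b \<in> M \<Longrightarrow> way_below r b x"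
  shows "\<exists>d\<in>B. way_below r d x \<and> (\<forall>b\<in>M. way_below r b d)"
proof -
  have "\<forall>b\<in>M. \<exists>d. d \<in> B \<and> way_below r b d \<and> way_below r d x"
    using way_below_interpolation[OF dcpo_Partial_order B] M(2) by blast
  then obtain k where k: "\<forall>b\<in>M. k b \<in> B \<and> way_below r b (k b) \<and> way_below r (k b) x"
    by (rule bchoice[THEN exE])
  have "finite (k ` M)" "k ` M \<subseteq> {b\<in>B. way_below r b x}" using M k by auto
  from directed_finite_upper_bound[OF dcpo_Partial_order basis_directed[OF x] this]
  obtain d where d: "d \<in> B" "way_below r d x" "\<forall>c\<in>k ` M. (c, d) \<in> r" by blast
  have "way_below r b d" if "b \<in> M" for b
    using way_below_le_trans[OF dcpo_Partial_order, of b "k b" d] k d that by simp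
  with d show ?thesis by blast
qed

text \<open>An \<open>n\<close> below no member of \<open>X\<close> is itself an object in
  \<open>objs_of\<close> of \<open>X\<close>, and reflexivity of \<open>r\<close> then excludes it
  as an attribute. The other inclusion is transitivity.\<close>

lemma closure_of_basis_context:
  assumes X: "X \<subseteq> B"
  shows "closure_of (basis_context r B) X = {b\<in>B. \<exists>c\<in>X. (b, c) \<in> r}"
proof -
  have "objs_of (basis_context r B) X = {m\<in>B. \<forall>c\<in>X. (m, c) \<notin> r}"
    using X by (auto simp: objs_of_def basis_context_def)
  moreover have "attrs_of (basis_context r B) A = {n\<in>B. \<forall>m\<in>A. (m, n) \<notin> r}" if "A \<subseteq> B" for A
    using that by (auto simp: attrs_of_def basis_context_def)
  moreover have "{n\<in>B. \<forall>m\<in>{m\<in>B. \<forall>c\<in>X. (m, c) \<notin> r}. (m, n) \<notin> r} = {b\<in>B. \<exists>c\<in>X. (b, c) \<in> r}"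
    using dcpo_Partial_order basis_refl by (auto simp: order_on_defs dest: transD)
  ultimately show ?thesis by auto
qed

lemma Ker_basis_context:
  "X \<subseteq> B \<Longrightarrow> Ker (basis_context r B) X = {b\<in>B. \<exists>c\<in>X. way_below r b c}"
  by (simp add: basis_context_def)

lemma br_basis_context:
  assumes X: "X \<subseteq> B"
  shows "br (basis_context r B) X = {b\<in>B. \<exists>c\<in>X. way_below r b c}"
proof -
  have "(\<exists>c\<in>{b\<in>B. \<exists>c\<in>X. (b, c) \<in> r}. way_below r b c) \<longleftrightarrow> (\<exists>c\<in>X. way_below r b c)" for b
  proof
    assume "\<exists>c\<in>X. way_below r b c"
    then show "\<exists>c\<in>{b\<in>B. \<exists>c\<in>X. (b, c) \<in> r}. way_below r b c" using X basis_refl by blast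
  qed (use way_below_le_trans[OF dcpo_Partial_order] in blast)
  then show ?thesis by (simp add: br_def closure_of_basis_context[OF X] Ker_basis_context)
qed

lemma br_basis_context_max:
  assumes "F \<subseteq> B" "m \<in> F" "\<forall>x\<in>F. (x, m) \<in> r"
  shows "br (basis_context r B) F = {b\<in>B. way_below r b m}"
  unfolding br_basis_context[OF assms(1)] using assms(2,3) way_below_le_trans[OF dcpo_Partial_order] by blast

lemma singleton_mem_Sel: "d \<in> B \<Longrightarrow> {d} \<in> Sel (basis_context r B)"
  by (simp add: basis_context_def basis_refl)

lemma Sel_basis_contextE:
  assumes "F \<in> Sel (basis_context r B)"
  obtains m where "finite F" "F \<subseteq> B" "m \<in> F" "m \<in> B" "\<forall>x\<in>F. (x, m) \<in> r"
    "br (basis_context r B) F = {b\<in>B. way_below r b m}"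
  using assms br_basis_context_max by (auto simp: basis_context_def)

lemma basis_context_interpolate:
  assumes F: "F \<in> Sel (basis_context r B)" and M: "finite M" "M \<subseteq> br (basis_context r B) F"
  shows "\<exists>d\<in>B. d \<in> br (basis_context r B) F \<and> (\<forall>b\<in>M. way_below r b d)"
proof -
  obtain m where m: "m \<in> B" "br (basis_context r B) F = {b\<in>B. way_below r b m}"
    using Sel_basis_contextE[OF F] by metis
  then show ?thesis
    using way_below_interpolation_finite[OF basis_Field[OF m(1)] M(1)] M(2) by auto
qed

text \<open>The witness is \<open>insert d M\<close>, where the interpolant \<open>d\<close> is the
  greatest element. The last conjunct serves the strong form of (AR3), and it is why all finite sets
  with a greatest element are selected and not just singletons.\<close>

lemma basis_context_Sel_between:
  assumes F: "F \<in> Sel (basis_context r B)" and M: "finite M" "M \<subseteq> br (basis_context r B) F"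
  shows "\<exists>G\<in>Sel (basis_context r B). M \<subseteq> br (basis_context r B) G \<and> G \<subseteq> br (basis_context r B) F \<and> M \<subseteq> G"
proof -
  obtain d where d: "d \<in> B" "d \<in> br (basis_context r B) F" "\<forall>b\<in>M. way_below r b d"
    using basis_context_interpolate[OF assms] by blast
  have MB: "insert d M \<subseteq> B" using M(2) d(1) Sel_basis_contextE[OF F] by blast
  have le: "\<forall>x\<in>insert d M. (x, d) \<in> r" using d way_below_imp_le[OF dcpo_Partial_order] basis_refl by auto
  then have "insert d M \<in> Sel (basis_context r B)" using MB M(1) by (auto simp: basis_context_def)
  moreover have "M \<subseteq> br (basis_context r B) (insert d M)"
    using br_basis_context_max[OF MB _ le] d(3) MB by auto
  ultimately show ?thesis using d(2) M(2) by blast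
qed

lemma attribute_continuous_basis_context: "attribute_continuous (basis_context r B)"
proof -
  have A: "Attrs (basis_context r B) = B" by (simp add: basis_context_def)
  have Ker_closure: "Ker (basis_context r B) (closure_of (basis_context r B) X) =
      {b\<in>B. \<exists>c\<in>X. way_below r b c}" if "X \<subseteq> B" for X
    using br_basis_context[OF that] by (simp add: br_def)
  have "kernel_attribute_operator (basis_context r B)"
    unfolding kernel_attribute_operator_def A
  proof (intro conjI allI impI)
    show "Ker (basis_context r B) \<in> Pow B \<rightarrow>\<^sub>E Pow B"
      by (auto simp: basis_context_def)
  next
    fix X assume X: "X \<subseteq> B"
    show "Ker (basis_context r B) (closure_of (basis_context r B) X) \<subseteq> closure_of (basis_context r B) X"
      unfolding Ker_closure[OF X] unfolding closure_of_basis_context[OF X]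
      using way_below_imp_le[OF dcpo_Partial_order] by blast
    \<comment> \<open>Idempotence of the kernel operator: transitivity from left to right,
      interpolation from right to left.\<close>
    have "(\<exists>d\<in>{b\<in>B. \<exists>c\<in>X. way_below r b c}. way_below r b d) \<longleftrightarrow> (\<exists>c\<in>X. way_below r b c)" for b
    proof
      assume "\<exists>c\<in>X. way_below r b c"
      then obtain c where c: "c \<in> X" "way_below r b c" by blast
      then obtain d where "d \<in> B" "way_below r b d" "way_below r d c"
        using way_below_interpolation[OF dcpo_Partial_order B] by blast
      with c(1) show "\<exists>d\<in>{b\<in>B. \<exists>c\<in>X. way_below r b c}. way_below r b d" by blast
    qed (use way_below_trans[OF dcpo_Partial_order] in blast)
    then show "Ker (basis_context r B) (Ker (basis_context r B) (closure_of (basis_context r B) X)) =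
      Ker (basis_context r B) (closure_of (basis_context r B) X)"
      by (simp add: Ker_closure[OF X] Ker_basis_context)
  next
    fix X Y assume "X \<subseteq> Y \<and> Y \<subseteq> B"
    then show "Ker (basis_context r B) (closure_of (basis_context r B) X) \<subseteq>
      Ker (basis_context r B) (closure_of (basis_context r B) Y)"
      by (subst Ker_closure, blast)+ blast
  qed
  moreover have "consistent_selection (basis_context r B)"
    unfolding consistent_selection_def A
  proof (intro conjI ballI allI impI)
    \<comment> \<open>Nonemptiness of the poset enters here: the basis elements way below
      \<open>x\<close> form a directed, hence nonempty, set.\<close>
    obtain x where "x \<in> Field r" using ne by blast
    then have "{b\<in>B. way_below r b x} \<noteq> {}" using basis_directed[of x] by (simp add: directed_def)
    then obtain b where "b \<in> B" by blast
    then show "Sel (basis_context r B) \<noteq> {}" using singleton_mem_Sel by blast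
  next
    fix F assume F: "F \<in> Sel (basis_context r B)"
    then show "finite F" "F \<noteq> {}" "F \<subseteq> B" by (auto simp: basis_context_def)
    fix M assume "finite M \<and> M \<subseteq> br (basis_context r B) F"
    then show "\<exists>G\<in>Sel (basis_context r B). M \<subseteq> br (basis_context r B) G \<and> G \<subseteq> br (basis_context r B) F"
      using basis_context_Sel_between[OF F, of M] by blast
  qed
  moreover have "Sat (basis_context r B) \<subseteq> Objs (basis_context r B) \<times> Attrs (basis_context r B)"
    by (auto simp: basis_context_def)
  ultimately show ?thesis by (simp add: attribute_continuous_def)
qed

text \<open>This admits the context to the strict category, so one construction gives essential
  surjectivity for both versions.\<close>

lemma strict_F_ident_basis_context:
  "strict_F_morphism (basis_context r B) (basis_context r B) (F_ident (basis_context r B))"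
proof -
  have "F_morphism (basis_context r B) (basis_context r B) (F_ident (basis_context r B))"
    by (rule F_morphism_F_ident[OF attribute_continuous_basis_context])
  moreover have "AR3 (basis_context r B) (basis_context r B) (F_ident (basis_context r B))"
    unfolding AR3_def
  proof (intro ballI allI impI)
    fix F M assume F: "F \<in> Sel (basis_context r B)"
      and M: "finite M \<and> M \<subseteq> Attrs (basis_context r B) \<and> rel_all F (F_ident (basis_context r B)) M"
    have "M \<subseteq> br (basis_context r B) F"
    proof
      fix x assume "x \<in> M"
      then have "(F, x) \<in> F_ident (basis_context r B)" using M by (simp add: rel_all_def)
      then show "x \<in> br (basis_context r B) F" by (simp add: F_ident_def)
    qed
    from basis_context_Sel_between[OF F conjunct1[OF M] this] obtain G
      where G: "G \<in> Sel (basis_context r B)" "G \<subseteq> br (basis_context r B) F" "M \<subseteq> G" by blast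
    have "G \<subseteq> Attrs (basis_context r B)" by (rule Sel_Attrs[OF attribute_continuous_basis_context G(1)])
    then have "rel_all F (F_ident (basis_context r B)) G"
      unfolding rel_all_def F_ident_def using F G(2) by blast
    with G show "\<exists>K\<in>Sel (basis_context r B). M \<subseteq> K \<and> rel_all F (F_ident (basis_context r B)) K"
      by blast
  qed
  ultimately show ?thesis by (simp add: F_morphism_def strict_F_morphism_def)
qed

lemma way_below_set_mem_pts:
  assumes x: "x \<in> Field r"
  shows "{b\<in>B. way_below r b x} \<in> pts (basis_context r B)"
  unfolding pts_def
proof (intro CollectI conjI ballI allI impI)
  show "{b\<in>B. way_below r b x} \<subseteq> Attrs (basis_context r B)" by (auto simp: basis_context_def)
next
  fix F assume F: "F \<subseteq> {b\<in>B. way_below r b x}"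
  then have "F \<subseteq> B" by blast
  from br_basis_context[OF this] show "br (basis_context r B) F \<subseteq> {b\<in>B. way_below r b x}"
    using F way_below_trans[OF dcpo_Partial_order] by blast
next
  fix M assume M: "finite M \<and> M \<subseteq> {b\<in>B. way_below r b x}"
  then obtain d where d: "d \<in> B" "way_below r d x" "\<forall>b\<in>M. way_below r b d"
    using way_below_interpolation_finite[OF x, of M] by auto
  then have "M \<subseteq> br (basis_context r B) {d}" using M br_basis_context[of "{d}"] by auto
  with d show "\<exists>F\<in>Sel (basis_context r B). F \<subseteq> {b\<in>B. way_below r b x} \<and> M \<subseteq> br (basis_context r B) F"
    using singleton_mem_Sel[OF d(1)] by (intro bexI[of _ "{d}"]) auto
qed

text \<open>Each finite part of \<open>X\<close> lies way below an element of \<open>X\<close>, the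
  greatest element of a selected set. Hence \<open>X\<close> is directed in \<open>r\<close>, and
  its supremum is the required \<open>x\<close>.\<close>

lemma pts_basis_context_eq:
  assumes X: "X \<in> pts (basis_context r B)"
  shows "\<exists>x\<in>Field r. X = {b\<in>B. way_below r b x}"
proof -
  have XB: "X \<subseteq> B" using X by (auto simp: pts_def basis_context_def)
  have up: "\<exists>m\<in>X. \<forall>b\<in>M. way_below r b m" if "finite M" "M \<subseteq> X" for M
  proof -
    obtain F where F: "F \<in> Sel (basis_context r B)" "F \<subseteq> X" "M \<subseteq> br (basis_context r B) F"
      using pts_finite_upper_bound[OF X \<open>finite M\<close> \<open>M \<subseteq> X\<close>] by blast
    from Sel_basis_contextE[OF F(1)] obtain m
      where "m \<in> F" "br (basis_context r B) F = {b\<in>B. way_below r b m}" by metis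
    with F show ?thesis by auto
  qed
  have "directed r X"
    unfolding directed_def
  proof (intro conjI ballI)
    show "X \<subseteq> Field r" using XB basis_Field by blast
    show "X \<noteq> {}" using up[of "{}"] by blast
    fix x y assume "x \<in> X" "y \<in> X"
    then obtain m where "m \<in> X" "way_below r x m" "way_below r y m" using up[of "{x, y}"] by auto
    then show "\<exists>z\<in>X. (x, z) \<in> r \<and> (y, z) \<in> r" using way_below_imp_le[OF dcpo_Partial_order] by blast
  qed
  then obtain s where s: "is_lub r X s" using dcpo by (auto simp: dcpo_def)
  have sF: "s \<in> Field r" using s by (simp add: is_lub_def)
  have "X = {b\<in>B. way_below r b s}"
  proof
    show "X \<subseteq> {b\<in>B. way_below r b s}"
    proof
      fix b assume "b \<in> X"
      then obtain m where m: "m \<in> X" "way_below r b m" using up[of "{b}"] by auto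
      moreover have "(m, s) \<in> r" using m(1) s by (simp add: is_lub_def)
      ultimately have "way_below r b s" using way_below_le_trans[OF dcpo_Partial_order] by blast
      then show "b \<in> {b\<in>B. way_below r b s}" using \<open>b \<in> X\<close> XB by blast
    qed
    show "{b\<in>B. way_below r b s} \<subseteq> X"
    proof
      fix b assume b: "b \<in> {b\<in>B. way_below r b s}"
      moreover have "(s, s) \<in> r" using sF dcpo_Partial_order by (simp add: order_on_defs refl_on_def)
      ultimately obtain c where c: "c \<in> X" "(b, c) \<in> r"
        using s \<open>directed r X\<close> unfolding way_below_def by blast
      \<comment> \<open>Points are closed under brackets, so \<open>b\<close> below \<open>c\<close>
        does not yet suffice. Roundedness puts \<open>c\<close> way below some \<open>m\<close> in
        \<open>X\<close>, and then \<open>b\<close> lies in the bracket of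
        \<open>{m}\<close>.\<close>
      then obtain m where m: "m \<in> X" "way_below r c m" using up[of "{c}"] by auto
      then have "b \<in> br (basis_context r B) {m}"
        using br_basis_context[of "{m}"] XB b le_way_below_trans[OF dcpo_Partial_order c(2)] by auto
      moreover have "br (basis_context r B) {m} \<subseteq> X"
        using pts_br_subset[OF X singleton_mem_Sel] m(1) XB by auto
      ultimately show "b \<in> X" by blast
    qed
  qed
  with sF show ?thesis by blast
qed

lemma way_below_set_subset_iff:
  assumes "x \<in> Field r" "y \<in> Field r"
  shows "{b\<in>B. way_below r b x} \<subseteq> {b\<in>B. way_below r b y} \<longleftrightarrow> (x, y) \<in> r"
proof
  assume sub: "{b\<in>B. way_below r b x} \<subseteq> {b\<in>B. way_below r b y}"
  have "(b, y) \<in> r" if "b \<in> {b\<in>B. way_below r b x}" for b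
    using that sub way_below_imp_le[OF dcpo_Partial_order] by blast
  then show "(x, y) \<in> r" using basis_is_lub[OF assms(1)] assms(2) by (simp add: is_lub_def)
qed (use way_below_le_trans[OF dcpo_Partial_order] in blast)

lemma isomorphism_basis_context:
  fixes e :: "'u set \<Rightarrow> 'u"
  assumes e: "inj_on e (pts (basis_context r B))"
  shows "\<exists>f. isomorphism (CD \<kappa>) r (pts_order e (basis_context r B)) f"
proof -
  let ?f = "\<lambda>x. e {b\<in>B. way_below r b x}"
  have "isomorphism (CD \<kappa>) r (pts_order e (basis_context r B)) (restrict ?f (Field r))"
  proof (rule isomorphism_CD_of_order_iso[OF dcpo_Partial_order])
    show "Partial_order (pts_order e (basis_context r B))"
      by (rule Partial_order_pts_order[OF attribute_continuous_basis_context e])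
    show "?f ` Field r = Field (pts_order e (basis_context r B))"
      unfolding Field_pts_order using way_below_set_mem_pts pts_basis_context_eq by blast
    show "(?f x, ?f y) \<in> pts_order e (basis_context r B) \<longleftrightarrow> (x, y) \<in> r"
      if "x \<in> Field r" "y \<in> Field r" for x y
      using that by (simp add: pts_order_iff[OF e] way_below_set_mem_pts way_below_set_subset_iff)
  qed
  then show ?thesis by blast
qed

end

section \<open>The equivalence\<close>

text \<open>For small contexts the power-set hypothesis makes this injective on all subsets of the
  attributes, in particular on points.\<close>

definition point_code :: "('u, 'u) fcontext \<Rightarrow> 'u set \<Rightarrow> 'u" where
  "point_code P = (SOME e. inj_on e (Pow (Attrs P)))"

definition pts_functor ::
  "(('u, 'u) fcontext, ('u set \<times> 'u) set, 'u rel, 'u \<Rightarrow> 'u) functor_data" where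
  "pts_functor =
    \<lparr>on_ob = (\<lambda>P. pts_order (point_code P) P),
     on_hom = (\<lambda>P Q H. restrict (\<lambda>u. point_code Q (map_of_rel P H (inv_into (pts P) (point_code P) u))) (point_code P ` pts P))\<rparr>"

lemma inj_point_code:
  assumes "|Pow (Attrs P)| \<le>o |UNIV :: 'u set|"
  shows "inj_on (point_code P :: 'u set \<Rightarrow> 'u) (pts P)"
proof -
  have "\<exists>e :: 'u set \<Rightarrow> 'u. inj_on e (Pow (Attrs P))" using assms by (auto simp: card_of_ordLeq[symmetric])
  then have "inj_on (point_code P) (Pow (Attrs P))" unfolding point_code_def by (rule someI_ex)
  then show ?thesis by (rule inj_on_subset) (auto simp: pts_def)
qed

lemma F_morphism_F_comp:
  assumes "attribute_continuous P" "attribute_continuous Q" "attribute_continuous R"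
    "F_morphism P Q H" "F_morphism Q R H'"
  shows "F_morphism P R (F_comp P Q R H H')"
  unfolding F_comp_eq_rel_of[OF assms(1,2,4,5)]
  by (intro F_morphism_rel_of continuous_on_pts_comp[OF continuous_map_of_rel continuous_map_of_rel] assms)

text \<open>\<open>C\<close> stands for either version. Its objects lie in \<open>ACC\<close>, which
  gives attribute continuity and size, and include those of \<open>strict_ACC\<close>, so the
  context of every small basis is available. In the strict case the hypothesis on hom-sets is
  \<open>strict_F_morphism_iff\<close>.\<close>

lemma equivalent_categories_CD:
  fixes \<kappa> :: "'k rel" and C :: "(('u, 'u) fcontext, ('u set \<times> 'u) set) category"
  assumes \<kappa>: "Cinfinite \<kappa>"
    and pow: "\<And>A :: 'u set. |A| <o \<kappa> \<Longrightarrow> |Pow A| \<le>o |UNIV :: 'u set|"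
    and Ob: "Ob (strict_ACC \<kappa>) \<subseteq> Ob C" "Ob C \<subseteq> Ob (ACC \<kappa>)"
    and Hom: "\<And>P Q. P \<in> Ob C \<Longrightarrow> Q \<in> Ob C \<Longrightarrow> Hom C P Q = {H. F_morphism P Q H}"
    and Ident: "Ident C = F_ident" and Comp: "Comp C = F_comp"
  shows "equivalent_categories C (CD \<kappa> :: ('u rel, 'u \<Rightarrow> 'u) category)"
proof -
  have ac: "attribute_continuous P" and small: "|Attrs P| <o \<kappa>" if "P \<in> Ob C" for P
    using subsetD[OF Ob(2) that] by (simp_all add: ACC_def)
  have e: "inj_on (point_code P) (pts P)" if "P \<in> Ob C" for P
    by (rule inj_point_code[OF pow[OF small[OF that]]])
  have onob: "on_ob pts_functor P \<in> Ob (CD \<kappa>)" if P: "P \<in> Ob C" for P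
  proof -
    let ?r = "pts_order (point_code P) P"
    have "|point_code P ` br P ` Sel P| \<le>o |Sel P|"
      by (simp only: image_image card_of_image)
    also have "|Sel P| \<le>o |{F. F \<subseteq> Attrs P \<and> finite F}|"
      using Sel_finite[OF ac[OF P]] Sel_Attrs[OF ac[OF P]] by (intro card_of_mono1) auto
    also have "|{F. F \<subseteq> Attrs P \<and> finite F}| <o \<kappa>" by (rule Fpow_ordLess[OF \<kappa> small[OF P]])
    finally have "|point_code P ` br P ` Sel P| <o \<kappa>" .
    moreover have basis: "domain_basis ?r (point_code P ` br P ` Sel P)"
      by (rule domain_basis_br[OF ac[OF P] e[OF P]])
    moreover have "continuous_domain ?r"
      unfolding continuous_domain_def using dcpo_pts_order[OF ac[OF P] e[OF P]] basis by blast
    moreover have "Field ?r \<noteq> {}" by (rule Field_pts_order_nonempty[OF ac[OF P]])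
    ultimately show ?thesis
      unfolding CD_def pts_functor_def category.simps functor_data.simps by blast
  qed
  have onid: "on_hom pts_functor P P (F_ident P) = Ident (CD \<kappa>) (on_ob pts_functor P)"
    if P: "P \<in> Ob C" for P
    unfolding pts_functor_def CD_def Field_pts_order category.simps functor_data.simps
  proof (rule restrict_ext)
    fix u assume "u \<in> point_code P ` pts P"
    then obtain X where X: "X \<in> pts P" "u = point_code P X" by blast
    then have "inv_into (pts P) (point_code P) u = X" using e[OF P] by simp
    then show "point_code P (map_of_rel P (F_ident P) (inv_into (pts P) (point_code P) u)) = u"
      using X map_of_rel_of[OF ac[OF P] continuous_on_pts_ident X(1)] by (simp add: F_ident_eq_rel_of[OF ac[OF P]])
  qed
  have onhom: "on_hom pts_functor P Q H \<in> Hom (CD \<kappa>) (on_ob pts_functor P) (on_ob pts_functor Q)"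
    if PQ: "P \<in> Ob C" "Q \<in> Ob C" and H: "F_morphism P Q H" for P Q H
    unfolding pts_functor_def CD_def category.simps functor_data.simps mem_Collect_eq
    by (intro scott_continuous_encode continuous_map_of_rel ac e PQ H)
  have oncomp: "on_hom pts_functor P R (F_comp P Q R H H') =
      Comp (CD \<kappa>) (on_ob pts_functor P) (on_ob pts_functor Q) (on_ob pts_functor R)
        (on_hom pts_functor P Q H) (on_hom pts_functor Q R H')"
    if PQR: "P \<in> Ob C" "Q \<in> Ob C" "R \<in> Ob C" and H: "F_morphism P Q H" "F_morphism Q R H'"
    for P Q R H H'
  proof -
    have c: "continuous_on_pts P Q (map_of_rel P H)" "continuous_on_pts Q R (map_of_rel Q H')"
      by (intro continuous_map_of_rel ac PQR H)+
    have mc: "map_of_rel P (F_comp P Q R H H') X = map_of_rel Q H' (map_of_rel P H X)"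
      if "X \<in> pts P" for X
      unfolding F_comp_eq_rel_of[OF ac[OF PQR(1)] ac[OF PQR(2)] H]
      by (rule map_of_rel_of[OF ac[OF PQR(1)] continuous_on_pts_comp[OF c] that])
    have mp: "map_of_rel P H X \<in> pts Q" if "X \<in> pts P" for X
      using c(1) that by (auto simp: continuous_on_pts_def)
    show ?thesis
      unfolding pts_functor_def CD_def Field_pts_order category.simps functor_data.simps compose_def
    proof (rule restrict_ext)
      fix u assume "u \<in> point_code P ` pts P"
      then obtain X where X: "X \<in> pts P" "u = point_code P X" by blast
      show "point_code R (map_of_rel P (F_comp P Q R H H') (inv_into (pts P) (point_code P) u)) =
        (\<lambda>u\<in>point_code Q ` pts Q. point_code R (map_of_rel Q H' (inv_into (pts Q) (point_code Q) u)))
          ((\<lambda>u\<in>point_code P ` pts P. point_code Q (map_of_rel P H (inv_into (pts P) (point_code P) u))) u)"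
        using X(1) mp[OF X(1)]
        by (simp add: X(2) mc inv_into_f_f[OF e[OF PQR(1)]] inv_into_f_f[OF e[OF PQR(2)]])
    qed
  qed
  have F: "is_functor C (CD \<kappa>) pts_functor"
    by (simp add: is_functor_def Hom Ident Comp onob onid onhom oncomp)
  have inj: "inj_on (on_hom pts_functor P Q) (Hom C P Q)" if PQ: "P \<in> Ob C" "Q \<in> Ob C" for P Q
  proof (rule inj_onI)
    fix H H' assume "H \<in> Hom C P Q" "H' \<in> Hom C P Q"
      and eq: "on_hom pts_functor P Q H = on_hom pts_functor P Q H'"
    then have H: "F_morphism P Q H" "F_morphism P Q H'" by (simp_all add: Hom PQ)
    have "map_of_rel P H X = map_of_rel P H' X" if X: "X \<in> pts P" for X
    proof -
      have "point_code Q (map_of_rel P H X) = point_code Q (map_of_rel P H' X)"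
        using fun_cong[OF eq, of "point_code P X"] X e[OF PQ(1)] by (simp add: pts_functor_def)
      moreover have "map_of_rel P H X \<in> pts Q" "map_of_rel P H' X \<in> pts Q"
        by (intro map_of_rel_mem_pts ac PQ H X)+
      ultimately show ?thesis using e[OF PQ(2)] by (auto dest: inj_onD)
    qed
    \<comment> \<open>Brackets are points, so agreement of the maps on points gives agreement of the
      relations recovered from them.\<close>
    then have "rel_of P (map_of_rel P H) = rel_of P (map_of_rel P H')"
      using br_mem_pts[OF ac[OF PQ(1)]] by (auto simp: rel_of_def)
    then show "H = H'" using rel_of_map_of_rel[OF ac[OF PQ(1)] ac[OF PQ(2)]] H by metis
  qed
  have C: "is_category C"
  proof (rule is_category_of_faithful_functor[OF is_category_CD F _ _ inj])
    show "Ident C P \<in> Hom C P P" if "P \<in> Ob C" for P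
      using F_morphism_F_ident[OF ac[OF that]] that by (simp add: Ident Hom)
    show "Comp C P Q R H H' \<in> Hom C P R"
      if "P \<in> Ob C" "Q \<in> Ob C" "R \<in> Ob C" "H \<in> Hom C P Q" "H' \<in> Hom C Q R" for P Q R H H'
      using that F_morphism_F_comp[OF ac ac ac] by (simp add: Comp Hom)
  qed
  show ?thesis
  proof (rule equivalence_criterion[OF C is_category_CD F])
    fix P Q assume PQ: "P \<in> Ob C" "Q \<in> Ob C"
    have "f \<in> on_hom pts_functor P Q ` Hom C P Q"
      if "f \<in> Hom (CD \<kappa>) (on_ob pts_functor P) (on_ob pts_functor Q)" for f
    proof
      from that have f: "scott_continuous (pts_order (point_code P) P) (pts_order (point_code Q) Q) f"
        by (simp add: CD_def pts_functor_def)
      \<comment> \<open>The preimage of \<open>f\<close>: read through the codes it is a map of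
        points, whose relation is the morphism sought.\<close>
      define \<phi> where "\<phi> = (\<lambda>X. inv_into (pts Q) (point_code Q) (f (point_code P X)))"
      have \<phi>: "continuous_on_pts P Q \<phi>" unfolding \<phi>_def
        by (intro continuous_on_pts_decode ac e PQ f)
      show "rel_of P \<phi> \<in> Hom C P Q" using F_morphism_rel_of[OF ac ac \<phi>] PQ by (simp add: Hom)
      have fF: "f \<in> point_code P ` pts P \<rightarrow>\<^sub>E point_code Q ` pts Q"
        using f by (simp add: scott_continuous_def Field_pts_order)
      have "f (point_code P X) = point_code Q (map_of_rel P (rel_of P \<phi>) X)" if "X \<in> pts P" for X
      proof -
        have "f (point_code P X) \<in> point_code Q ` pts Q" using fF that by auto
        then show ?thesis
          using map_of_rel_of[OF ac[OF PQ(1)] \<phi> that] by (simp add: \<phi>_def f_inv_into_f)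
      qed
      then show "f = on_hom pts_functor P Q (rel_of P \<phi>)"
        using fF e[OF PQ(1)] by (auto simp: pts_functor_def fun_eq_iff PiE_iff extensional_def)
    qed
    moreover have "on_hom pts_functor P Q ` Hom C P Q \<subseteq> Hom (CD \<kappa>) (on_ob pts_functor P) (on_ob pts_functor Q)"
      using F PQ unfolding is_functor_def by blast
    ultimately show "bij_betw (on_hom pts_functor P Q) (Hom C P Q)
      (Hom (CD \<kappa>) (on_ob pts_functor P) (on_ob pts_functor Q))"
      using inj[OF PQ] unfolding bij_betw_def by blast
  next
    fix r :: "'u rel" assume "r \<in> Ob (CD \<kappa>)"
    then obtain B where r: "dcpo r" "domain_basis r B" "Field r \<noteq> {}" and B: "|B| <o \<kappa>"
      by (auto simp: CD_def continuous_domain_def)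
    \<comment> \<open>The small basis is both object set and attribute set, so the size bound holds
      even when the domain itself is larger.\<close>
    have "basis_context r B \<in> Ob (strict_ACC \<kappa>)"
      using attribute_continuous_basis_context[OF r] strict_F_ident_basis_context[OF r] B
      by (simp add: strict_ACC_def basis_context_def)
    then have P: "basis_context r B \<in> Ob C" using Ob(1) by blast
    then show "\<exists>P\<in>Ob C. \<exists>f. isomorphism (CD \<kappa>) r (on_ob pts_functor P) f"
      using isomorphism_basis_context[OF r e[OF P]] by (intro bexI[of _ "basis_context r B"]) (simp_all add: pts_functor_def)
  qed
qed

theorem theorem4p12:
  fixes \<kappa> :: "'k rel"
  assumes "Cinfinite \<kappa>"
    and "\<And>A :: 'u set. |A| <o \<kappa> \<Longrightarrow> |Pow A| \<le>o |UNIV :: 'u set|"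
  shows "equivalent_categories
      (ACC \<kappa> :: (('u, 'u) fcontext, ('u set \<times> 'u) set) category)
      (CD \<kappa> :: ('u rel, 'u \<Rightarrow> 'u) category)
    \<and> equivalent_categories
      (strict_ACC \<kappa> :: (('u, 'u) fcontext, ('u set \<times> 'u) set) category)
      (CD \<kappa> :: ('u rel, 'u \<Rightarrow> 'u) category)"
  by (intro conjI equivalent_categories_CD[OF assms])
    (auto simp: ACC_def strict_ACC_def strict_F_morphism_iff)

end
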